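(* Let $p\geq 1$, $q\geq 0$ be integers. The totally geodesic submanifolds of $\mathcal H^{p,q}$ are precisely: (1) the vertical subspaces; (2) the intersections of quadric hypersurfaces of the form $$\|x-x_0\|^2-\|y-y_0\|^2+z^2=c,\qquad c\in\mathbb R,\ (x_0,y_0)\in\partial\mathcal H^{p,q},$$ with a vertical subspace.
   Context: The half-space model is $\mathcal H^{p,q}=\{(x,y,z)\in\mathbb R^{p-1}\oplus\mathbb R^q\oplus\mathbb R : z>0\}$ with the pseudo-Riemannian metric $g_{p,q}=\frac{dx_1^2+\dots+dx_{p-1}^2-dy_1^2-\dots-dy_q^2+dz^2}{z^2}$. $\|\cdot\|$ denotes the Euclidean norm on $\mathbb R^{p-1}$ and on $\mathbb R^q$. $\partial\mathcal H^{p,q}$ is the hyperplane $\{z=0\}$, identified with $\mathbb R^{p-1}\oplus\mathbb R^q$. The vertical subspaces are the sets $V_\ell=\{(x,y,z)\in\mathbb R^{p-1}\oplus\mathbb R^q\oplus\mathbb R : (x,y)\in\ell,\ z>0\}$, for $\ell$ an affine subspace of $\mathbb R^{p-1}\oplus\mathbb R^q$ of any dimension. The quadric hypersurfaces are understood as subsets of $\mathcal H^{p,q}$. A submanifold (possibly degenerate for $g_{p,q}$) is totally geodesic if every geodesic of $\mathcal H^{p,q}$ tangent to it at a point remains in it. Totally geodesic submanifolds are always implicitly assumed to be maximal, i.e. not properly included in any other totally geodesic submanifold of the same dimension.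
   Formalization: Maximality is taken among connected submanifolds, and (2) lists the connected components of the intersections (these can be empty or disconnected, e.g. z²−y²=−1 for p=q=1); every nonempty intersection is also shown to be totally geodesic. *)

theory Defs
  imports "HOL-Analysis.Analysis"
begin

section \<open>Smooth maps and embedded submanifolds\<close>

text \<open>Continuous differentiability of order \<open>n\<close>; meant for open \<open>U\<close>.\<close>

primrec Ck_on ::
  "nat \<Rightarrow> 'a::real_normed_vector set \<Rightarrow> ('a \<Rightarrow> 'b::real_normed_vector) \<Rightarrow> bool" where
  "Ck_on 0 U f \<longleftrightarrow> continuous_on U f"
| "Ck_on (Suc n) U f \<longleftrightarrow>
     (\<forall>x\<in>U. f differentiable (at x)) \<and>
     (\<forall>v. Ck_on n U (\<lambda>x. frechet_derivative f (at x) v))"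

definition smooth_on ::
  "'a::real_normed_vector set \<Rightarrow> ('a \<Rightarrow> 'b::real_normed_vector) \<Rightarrow> bool" where
  "smooth_on U f \<longleftrightarrow> (\<forall>n. Ck_on n U f)"

text \<open>Nonempty embedded submanifolds of pure dimension \<open>d\<close>, given by slice charts.
  Connectedness is not part of this definition.\<close>

definition submanifold :: "nat \<Rightarrow> 'a::euclidean_space set \<Rightarrow> bool" where
  "submanifold d M \<longleftrightarrow> M \<noteq> {} \<and>
     (\<forall>m\<in>M. \<exists>U (V :: 'a set) \<phi> \<psi> S. open U \<and> m \<in> U \<and> open V \<and>
        homeomorphism U V \<phi> \<psi> \<and> smooth_on U \<phi> \<and> smooth_on V \<psi> \<and>
        subspace S \<and> dim S = d \<and> \<phi> ` (U \<inter> M) = V \<inter> S)"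

text \<open>The tangent space as the set of velocities of curves lying in \<open>M\<close>.  For an embedded
  submanifold, curves that are merely differentiable at the base point yield the same vectors
  as smooth ones.\<close>

definition tangent_space :: "'a::real_normed_vector set \<Rightarrow> 'a \<Rightarrow> 'a set" where
  "tangent_space M m =
     {v. \<exists>c :: real \<Rightarrow> 'a. c 0 = m \<and> (\<forall>\<^sub>F t in nhds 0. c t \<in> M) \<and>
         (c has_vector_derivative v) (at 0)}"

section \<open>Geodesics of a pseudo-Riemannian metric on an open set\<close>

text \<open>A metric is given by its Gram matrix \<open>g w\<close> in the standard coordinates.\<close>

definition partial_derivative :: "'n::finite \<Rightarrow> (real ^ 'n \<Rightarrow> real) \<Rightarrow> real ^ 'n \<Rightarrow> real" where
  "partial_derivative i f w = frechet_derivative f (at w) (axis i 1)"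

text \<open>\<open>christoffel g w i j l\<close> is the Christoffel symbol of the Levi-Civita connection with
  upper index \<open>i\<close> and lower indices \<open>j\<close>, \<open>l\<close>.\<close>

definition christoffel ::
  "(real ^ 'n \<Rightarrow> real ^ 'n ^ 'n) \<Rightarrow> real ^ 'n \<Rightarrow> 'n::finite \<Rightarrow> 'n \<Rightarrow> 'n \<Rightarrow> real" where
  "christoffel g w i j l =
     (\<Sum>m\<in>UNIV. matrix_inv (g w) $ i $ m *
        (partial_derivative j (\<lambda>u. g u $ m $ l) w
         + partial_derivative l (\<lambda>u. g u $ m $ j) w
         - partial_derivative m (\<lambda>u. g u $ j $ l) w)) / 2"

text \<open>Affinely parametrised geodesic of \<open>(H, g)\<close> on the open interval \<open>I\<close>, with velocity
  \<open>\<gamma>'\<close>.\<close>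

definition geodesic ::
  "(real ^ 'n) set \<Rightarrow> (real ^ 'n \<Rightarrow> real ^ 'n ^ 'n::finite) \<Rightarrow>
   real set \<Rightarrow> (real \<Rightarrow> real ^ 'n) \<Rightarrow> (real \<Rightarrow> real ^ 'n) \<Rightarrow> bool" where
  "geodesic H g I \<gamma> \<gamma>' \<longleftrightarrow> open I \<and> is_interval I \<and> \<gamma> ` I \<subseteq> H \<and>
     (\<exists>\<gamma>''. \<forall>t\<in>I. (\<gamma> has_vector_derivative \<gamma>' t) (at t) \<and>
        (\<gamma>' has_vector_derivative \<gamma>'' t) (at t) \<and>
        (\<forall>i. \<gamma>'' t $ i +
          (\<Sum>j\<in>UNIV. \<Sum>l\<in>UNIV. christoffel g (\<gamma> t) i j l * \<gamma>' t $ j * \<gamma>' t $ l) = 0))"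

definition totally_geodesic ::
  "(real ^ 'n) set \<Rightarrow> (real ^ 'n \<Rightarrow> real ^ 'n ^ 'n::finite) \<Rightarrow> nat \<Rightarrow> (real ^ 'n) set \<Rightarrow> bool" where
  "totally_geodesic H g d M \<longleftrightarrow> M \<subseteq> H \<and> submanifold d M \<and>
     (\<forall>I \<gamma> \<gamma>'. geodesic H g I \<gamma> \<gamma>' \<and>
        (\<exists>t\<in>I. \<gamma> t \<in> M \<and> \<gamma>' t \<in> tangent_space M (\<gamma> t)) \<longrightarrow> \<gamma> ` I \<subseteq> M)"

text \<open>Maximality is only meaningful among connected submanifolds: otherwise, in positive
  codimension, adjoining a disjoint totally geodesic submanifold of the same dimension would
  always give a larger one.\<close>

definition maximal_totally_geodesic ::
  "(real ^ 'n) set \<Rightarrow> (real ^ 'n \<Rightarrow> real ^ 'n ^ 'n::finite) \<Rightarrow> (real ^ 'n) set \<Rightarrow> bool" where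
  "maximal_totally_geodesic H g M \<longleftrightarrow>
     (\<exists>d. totally_geodesic H g d M \<and> connected M \<and>
          \<not> (\<exists>N. totally_geodesic H g d N \<and> connected N \<and> M \<subset> N))"

section \<open>The half-space model\<close>

text \<open>The type \<open>real ^ 'n\<close> stands for the sum of the spaces of \<open>x\<close>, \<open>y\<close> and \<open>z\<close>: its
  coordinates are split into the \<open>p - 1\<close> coordinates \<open>x\<close> (index set \<open>X\<close>), the \<open>q\<close>
  coordinates \<open>y\<close> (index set \<open>Y\<close>) and \<open>z\<close> (index \<open>k\<close>).  Index sets, rather than index
  types, are used because both \<open>p - 1\<close> and \<open>q\<close> may be \<open>0\<close>.\<close>

definition half_space_coordinates ::
  "nat \<Rightarrow> nat \<Rightarrow> 'n::finite set \<Rightarrow> 'n set \<Rightarrow> 'n \<Rightarrow> bool" where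
  "half_space_coordinates p q X Y k \<longleftrightarrow>
     card X = p - 1 \<and> card Y = q \<and> X \<inter> Y = {} \<and> k \<notin> X \<union> Y \<and> X \<union> Y \<union> {k} = UNIV"

definition half_space :: "'n::finite \<Rightarrow> (real ^ 'n) set" where
  "half_space k = {w. w $ k > 0}"

definition half_space_metric ::
  "'n::finite set \<Rightarrow> 'n set \<Rightarrow> 'n \<Rightarrow> real ^ 'n \<Rightarrow> real ^ 'n ^ 'n" where
  "half_space_metric X Y k w =
     (\<chi> i j. if i \<noteq> j then 0
            else if i \<in> X then 1 / (w $ k)\<^sup>2
            else if i \<in> Y then - 1 / (w $ k)\<^sup>2
            else 1 / (w $ k)\<^sup>2)"

definition half_space_boundary :: "'n::finite \<Rightarrow> (real ^ 'n) set" where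
  "half_space_boundary k = {w. w $ k = 0}"

definition boundary_projection :: "'n::finite \<Rightarrow> real ^ 'n \<Rightarrow> real ^ 'n" where
  "boundary_projection k w = (\<chi> i. if i = k then 0 else w $ i)"

definition boundary_affine_subspace :: "'n::finite \<Rightarrow> (real ^ 'n) set \<Rightarrow> bool" where
  "boundary_affine_subspace k L \<longleftrightarrow> affine L \<and> L \<noteq> {} \<and> L \<subseteq> half_space_boundary k"

definition vertical_subspace :: "'n::finite \<Rightarrow> (real ^ 'n) set \<Rightarrow> (real ^ 'n) set" where
  "vertical_subspace k L = {w \<in> half_space k. boundary_projection k w \<in> L}"

definition half_space_quadric ::
  "'n::finite set \<Rightarrow> 'n set \<Rightarrow> 'n \<Rightarrow> real ^ 'n \<Rightarrow> real \<Rightarrow> (real ^ 'n) set" where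
  "half_space_quadric X Y k b c =
     {w \<in> half_space k.
        (\<Sum>i\<in>X. (w $ i - b $ i)\<^sup>2) - (\<Sum>i\<in>Y. (w $ i - b $ i)\<^sup>2) + (w $ k)\<^sup>2 = c}"

text \<open>The section of a quadric by a vertical subspace can be empty, or have two connected
  components: for \<open>p = q = 1\<close>, the section \<open>z\<^sup>2 - y\<^sup>2 = -1\<close> consists of two disjoint
  geodesics, no geodesic of the half-space joining one to the other.  The classification
  of connected totally geodesic submanifolds is therefore in terms of components of sections;
  a nonempty connected section is its own only component.\<close>

end

theory Submission
  imports Defs
begin

text \<open>
  Write a point of the half-space as \<open>(u, z)\<close> with \<open>u\<close> in the boundary, and let \<open>\<langle>_, _\<rangle>\<close> be the
  flat scalar product of the boundary.  The pseudo-Riemannian half-space is projectively flat: in the coordinates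
  \<open>(u, z\<^sup>2 + \<langle>u, u\<rangle>)\<close> (the map \<open>straighten\<close>, a diffeomorphism onto the open set \<open>straight_domain\<close>
  of points \<open>(u, \<tau>)\<close> with \<open>\<tau> > \<langle>u, u\<rangle>\<close>) its geodesics are reparametrised straight lines.  Indeed
  \<open>u' / z\<^sup>2\<close> and \<open>z' / z + \<langle>u, u'\<rangle> / z\<^sup>2\<close> are first integrals of the geodesic equation, and together
  they say that the velocity of the straightened curve is \<open>z\<^sup>2\<close> times a constant vector
  (\<open>geodesic_straighten_velocity\<close>).  Conversely every segment inside \<open>straight_domain\<close> carries a geodesic,
  obtained from a one-dimensional differential equation for the parameter (\<open>segment_geodesic\<close>).

  Hence totally geodesic should mean affine in these coordinates.  The preimage of an affine
  subspace, a \<open>flat_section\<close>, is totally geodesic because a line tangent to an affine subspace stays in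
  it (\<open>totally_geodesic_flat_section\<close>).  Conversely, a totally geodesic submanifold agrees
  near each of its points with the section of its tangent affine subspace
  (\<open>totally_geodesic_locally_flat\<close>): short segments in that subspace lie in the submanifold, and
  invariance of domain shows that they fill a neighbourhood.  The affine subspace is determined by the germ and so
  does not change along a connected submanifold.

  Sections need not be connected, since \<open>straight_domain\<close> is not convex as soon as \<open>q > 0\<close>.
  Their components are closed in the half-space, which suffices for maximality: a closed submanifold is open and
  closed in any connected submanifold of the same dimension that contains it.  This gives the classification
  \<open>maximal_totally_geodesic_iff_flat_component\<close>.

  It remains to translate.  An affine subspace whose direction contains the vertical axis pulls back to
  a vertical subspace.  The equation of a quadric centred at the boundary is affine in straight coordinates, and by
  nondegeneracy of the scalar product every other affine subspace arises from such a quadric together with a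
  vertical subspace (\<open>flat_section_cases\<close>).
\<close>

section \<open>Differentiability of finite order\<close>

lemma Ck_on_cong:
  assumes "open U" "\<And>x. x \<in> U \<Longrightarrow> f x = g x" "Ck_on n U f"
  shows "Ck_on n U g"
  using assms(2,3)
proof (induction n arbitrary: f g)
  case 0
  then show ?case using continuous_on_cong[of U U f g] by simp
next
  case (Suc n)
  have d: "(g has_derivative frechet_derivative f (at x)) (at x)" if "x \<in> U" for x
  proof -
    have "(f has_derivative frechet_derivative f (at x)) (at x)"
      using Suc.prems(2) that frechet_derivative_works by fastforce
    then show ?thesis
      using has_derivative_transform_within_open[OF _ assms(1) that] Suc.prems(1) by blast
  qed
  have eq: "frechet_derivative f (at x) = frechet_derivative g (at x)" if "x \<in> U" for x
    using frechet_derivative_at[OF d[OF that]] .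
  show ?case unfolding Ck_on.simps
  proof (intro conjI ballI allI)
    fix x assume "x \<in> U" then show "g differentiable (at x)"
      using d differentiable_def by blast
  next
    fix v
    have "Ck_on n U (\<lambda>x. frechet_derivative f (at x) v)"
      using Suc.prems(2) by simp
    then show "Ck_on n U (\<lambda>x. frechet_derivative g (at x) v)"
      by (rule Suc.IH[rotated]) (simp only: eq)
  qed
qed

text \<open>The recursion of \<^const>\<open>Ck_on\<close> speaks of the chosen Frechet derivative; this form
  accepts any explicit derivative instead, which is how all closure properties below are proved by
  induction on the order.\<close>

lemma Ck_on_SucI:
  assumes "open U" "\<And>x. x \<in> U \<Longrightarrow> (f has_derivative f' x) (at x)"
    "\<And>v. Ck_on n U (\<lambda>x. f' x v)"
  shows "Ck_on (Suc n) U f"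
  unfolding Ck_on.simps
proof (intro conjI ballI allI)
  fix x assume "x \<in> U" then show "f differentiable (at x)"
    using assms(2) differentiable_def by blast
next
  fix v
  show "Ck_on n U (\<lambda>x. frechet_derivative f (at x) v)"
    by (rule Ck_on_cong[OF assms(1) _ assms(3)[of v]])
       (use frechet_derivative_at[OF assms(2)] in auto)
qed

lemma Ck_on_SucD:
  assumes "Ck_on (Suc n) U f"
  shows "x \<in> U \<Longrightarrow> (f has_derivative frechet_derivative f (at x)) (at x)"
    and "Ck_on n U (\<lambda>x. frechet_derivative f (at x) v)"
  using assms frechet_derivative_works by auto

lemma Ck_on_Suc_imp: "Ck_on (Suc n) U f \<Longrightarrow> Ck_on n U f"
proof (induction n arbitrary: f)
  case 0
  then have "\<forall>x\<in>U. continuous (at x) f"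
    by (simp add: differentiable_imp_continuous_within)
  then show ?case
    by (simp add: continuous_at_imp_continuous_on)
next
  case (Suc n)
  show ?case
    unfolding Ck_on.simps(2)[of n]
  proof (intro conjI allI)
    show "\<forall>x\<in>U. f differentiable (at x)"
      using Suc.prems unfolding Ck_on.simps(2)[of "Suc n"] by (rule conjunct1)
    fix v
    show "Ck_on n U (\<lambda>x. frechet_derivative f (at x) v)"
      by (rule Suc.IH, rule Ck_on_SucD(2)[OF Suc.prems])
  qed
qed

lemma Ck_on_subset: "Ck_on n U f \<Longrightarrow> V \<subseteq> U \<Longrightarrow> Ck_on n V f"
proof (induction n arbitrary: f)
  case (Suc n)
  then show ?case by (simp add: subset_iff)
qed (auto intro: continuous_on_subset)

lemma Ck_on_const: "open U \<Longrightarrow> Ck_on n U (\<lambda>x. c)"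
proof (induction n arbitrary: c)
  case (Suc n)
  show ?case
    by (rule Ck_on_SucI[where f' = "\<lambda>x v. 0"]) (use Suc in auto)
qed simp

lemma Ck_on_bounded_linear:
  assumes "open U" "bounded_linear f"
  shows "Ck_on n U f"
proof (cases n)
  case 0
  then show ?thesis using assms by (simp add: linear_continuous_on)
next
  case (Suc m)
  show ?thesis unfolding Suc
    by (rule Ck_on_SucI[where f' = "\<lambda>x. f"])
       (use assms in \<open>auto intro: bounded_linear_imp_has_derivative Ck_on_const\<close>)
qed

lemma Ck_on_add:
  assumes "open U" "Ck_on n U f" "Ck_on n U g"
  shows "Ck_on n U (\<lambda>x. f x + g x)"
  using assms(2,3)
proof (induction n arbitrary: f g)
  case 0
  then show ?case by (simp add: continuous_on_add)
next
  case (Suc n)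
  show ?case
    by (rule Ck_on_SucI[OF assms(1) has_derivative_add[OF Ck_on_SucD(1) Ck_on_SucD(1)]])
       (assumption | rule Suc.prems Suc.IH Ck_on_SucD(2))+
qed

lemma Ck_on_scaleR:
  fixes f :: "'a::real_normed_vector \<Rightarrow> real"
  assumes "open U" "Ck_on n U f" "Ck_on n U g"
  shows "Ck_on n U (\<lambda>x. f x *\<^sub>R g x)"
  using assms(2,3)
proof (induction n arbitrary: f g)
  case 0
  then show ?case by (simp add: continuous_on_scaleR)
next
  case (Suc n)
  show ?case
    by (rule Ck_on_SucI[OF assms(1) has_derivative_scaleR[OF Ck_on_SucD(1) Ck_on_SucD(1)]])
       (assumption | rule Suc.prems Ck_on_add assms(1) Suc.IH Ck_on_Suc_imp[OF Suc.prems(1)]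
          Ck_on_Suc_imp[OF Suc.prems(2)] Ck_on_SucD(2))+
qed

lemmas Ck_on_mult = Ck_on_scaleR[where 'b = real, unfolded real_scaleR_def]

lemma Ck_on_sum:
  assumes "open U" "\<And>i. i \<in> I \<Longrightarrow> Ck_on n U (f i)"
  shows "Ck_on n U (\<lambda>x. \<Sum>i\<in>I. f i x)"
  using assms(2)
  by (induction I rule: infinite_finite_induct) (auto intro: Ck_on_const Ck_on_add assms(1))

text \<open>A power differentiates to a power with exponent lowered by one, so the induction on the
  order has to run over all exponents simultaneously.  The case of interest is the square root.\<close>

lemma Ck_on_powr:
  fixes f :: "'a::real_normed_vector \<Rightarrow> real"
  assumes "open U" "Ck_on n U f" "\<And>x. x \<in> U \<Longrightarrow> f x > 0"
  shows "Ck_on n U (\<lambda>x. f x powr a)"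
  using assms(2)
proof (induction n arbitrary: a)
  case 0
  moreover have "\<forall>x\<in>U. f x \<noteq> 0" using assms(3) by fastforce
  ultimately show ?case by (auto intro!: continuous_on_powr)
next
  case (Suc n)
  show ?case
  proof (rule Ck_on_SucI[OF assms(1), where f' = "\<lambda>x v. (a * f x powr (a - 1)) * frechet_derivative f (at x) v"])
    fix x assume x: "x \<in> U"
    show "((\<lambda>x. f x powr a) has_derivative (\<lambda>v. (a * f x powr (a - 1)) * frechet_derivative f (at x) v)) (at x)"
      by (rule has_derivative_eq_rhs[OF has_derivative_powr[OF Ck_on_SucD(1)[OF Suc.prems x]
            has_derivative_const assms(3)[OF x] UNIV_I]])
         (use assms(3)[OF x] in \<open>simp add: powr_diff field_simps\<close>)
  next
    fix v
    show "Ck_on n U (\<lambda>x. (a * f x powr (a - 1)) * frechet_derivative f (at x) v)"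
      by (intro Ck_on_mult assms(1) Ck_on_const Suc.IH Ck_on_SucD(2)[OF Suc.prems]
            Ck_on_Suc_imp[OF Suc.prems])
  qed
qed

section \<open>Submanifolds, tangent spaces and maximality\<close>

lemma smooth_on_has_derivative:
  assumes "smooth_on U f" "x \<in> U"
  shows "(f has_derivative frechet_derivative f (at x)) (at x)"
  using Ck_on_SucD(1)[of 0 U f x] assms unfolding smooth_on_def by blast

lemma smooth_on_subset: "smooth_on U f \<Longrightarrow> V \<subseteq> U \<Longrightarrow> smooth_on V f"
  unfolding smooth_on_def using Ck_on_subset by blast

lemma submanifoldE:
  fixes M :: "'a::euclidean_space set"
  assumes "submanifold d M" "m \<in> M"
  obtains U V :: "'a set" and \<phi> \<psi> S where "open U" "m \<in> U" "open V"
    "homeomorphism U V \<phi> \<psi>" "smooth_on U \<phi>" "smooth_on V \<psi>"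
    "subspace S" "dim S = d" "\<phi> ` (U \<inter> M) = V \<inter> S"
proof -
  have "\<exists>U (V :: 'a set) \<phi> \<psi> S. open U \<and> m \<in> U \<and> open V \<and>
        homeomorphism U V \<phi> \<psi> \<and> smooth_on U \<phi> \<and> smooth_on V \<psi> \<and>
        subspace S \<and> dim S = d \<and> \<phi> ` (U \<inter> M) = V \<inter> S"
    using bspec[OF conjunct2[OF assms(1)[unfolded submanifold_def]] assms(2)] .
  then show ?thesis
    by (elim exE conjE) (rule that)
qed

lemma submanifold_openin_subset:
  fixes M :: "'a::euclidean_space set"
  assumes M: "submanifold d M" and C: "openin (top_of_set M) C" "C \<noteq> {}"
  shows "submanifold d C"
  unfolding submanifold_def
proof (intro conjI ballI)
  fix m assume m: "m \<in> C"
  obtain O' where O': "open O'" "C = M \<inter> O'" using C(1) by (auto simp: openin_open)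
  obtain U and V :: "'a set" and \<phi> \<psi> S where chart: "open U" "m \<in> U" "open V"
    "homeomorphism U V \<phi> \<psi>" "smooth_on U \<phi>" "smooth_on V \<psi>"
    "subspace S" "dim S = d" "\<phi> ` (U \<inter> M) = V \<inter> S"
    using submanifoldE[OF M, of m] m O' by blast
  have V': "\<phi> ` (U \<inter> O') = V \<inter> \<psi> -` O'"
  proof (intro equalityI subsetI)
    fix v assume "v \<in> V \<inter> \<psi> -` O'"
    then have "\<psi> v \<in> U \<inter> O'" "v = \<phi> (\<psi> v)"
      using homeomorphism_image2[OF chart(4)] homeomorphism_apply2[OF chart(4)] by auto
    then show "v \<in> \<phi> ` (U \<inter> O')" by blast
  qed (use homeomorphism_image1[OF chart(4)] homeomorphism_apply1[OF chart(4)] in auto)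
  have hom: "homeomorphism (U \<inter> O') (V \<inter> \<psi> -` O') \<phi> \<psi>"
    by (rule homeomorphism_of_subsets[OF chart(4) _ _ V']) auto
  have "open (V \<inter> \<psi> -` O')"
    using continuous_open_preimage[OF homeomorphism_cont2[OF chart(4)] chart(3) O'(1)] .
  moreover have "\<phi> ` (U \<inter> O' \<inter> C) = V \<inter> \<psi> -` O' \<inter> S"
  proof -
    have "\<phi> ` (U \<inter> O' \<inter> C) = \<phi> ` (U \<inter> M) \<inter> \<phi> ` (U \<inter> O')"
    proof -
      have "inj_on \<phi> U"
        using homeomorphism_apply1[OF chart(4)] by (intro inj_on_inverseI[of _ \<psi>]) auto
      then have "\<phi> ` ((U \<inter> M) \<inter> (U \<inter> O')) = \<phi> ` (U \<inter> M) \<inter> \<phi> ` (U \<inter> O')"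
        by (rule inj_on_image_Int) auto
      moreover have "U \<inter> O' \<inter> C = (U \<inter> M) \<inter> (U \<inter> O')" using O'(2) by blast
      ultimately show ?thesis by simp
    qed
    then show ?thesis using V' chart(9) by blast
  qed
  moreover have "open (U \<inter> O')" "m \<in> U \<inter> O'" using chart(1,2) O' m by auto
  moreover have "smooth_on (U \<inter> O') \<phi>" "smooth_on (V \<inter> \<psi> -` O') \<psi>"
    using smooth_on_subset chart(5,6) by blast+
  ultimately show "\<exists>U (V :: 'a set) \<phi> \<psi> S. open U \<and> m \<in> U \<and> open V \<and>
        homeomorphism U V \<phi> \<psi> \<and> smooth_on U \<phi> \<and> smooth_on V \<psi> \<and>
        subspace S \<and> dim S = d \<and> \<phi> ` (U \<inter> C) = V \<inter> S"
    using hom chart(7,8) by (intro exI conjI)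
qed (use C in simp)

text \<open>Invariance of domain: read in the two slice charts, the inclusion of \<open>N\<close> into
  \<open>M\<close> is a continuous injection between open pieces of subspaces of the same dimension, hence
  an open map.  This is what forces two submanifolds of equal dimension, one inside the other, to
  agree locally.\<close>

lemma submanifold_openin_of_subset:
  fixes M N :: "'a::euclidean_space set"
  assumes M: "submanifold d M" and N: "submanifold d N" and sub: "N \<subseteq> M"
  shows "openin (top_of_set M) N"
proof (subst openin_subopen, intro ballI)
  fix n assume n: "n \<in> N"
  obtain U and V :: "'a set" and \<phi> \<psi> S where c: "open U" "n \<in> U" "open V"
    "homeomorphism U V \<phi> \<psi>" "smooth_on U \<phi>" "smooth_on V \<psi>"
    "subspace S" "dim S = d" "\<phi> ` (U \<inter> M) = V \<inter> S"
    using submanifoldE[OF M, of n] n sub by blast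
  obtain U' and V' :: "'a set" and \<phi>' \<psi>' S' where c': "open U'" "n \<in> U'" "open V'"
    "homeomorphism U' V' \<phi>' \<psi>'" "smooth_on U' \<phi>'" "smooth_on V' \<psi>'"
    "subspace S'" "dim S' = d" "\<phi>' ` (U' \<inter> N) = V' \<inter> S'"
    using submanifoldE[OF N n] by blast
  note i = homeomorphism_apply1[OF c(4)] and i' = homeomorphism_apply1[OF c'(4)]
  \<comment> \<open>\<open>T\<close> is the part of \<open>N\<close> covered by both charts, and \<open>A\<close> is \<open>T\<close> read in the chart of \<open>N\<close>\<close>
  define A where "A = (V' \<inter> \<psi>' -` U) \<inter> S'"
  define T where "T = U \<inter> U' \<inter> N"
  have im: "\<psi>' ` A = T"
  proof -
    have "A = \<phi>' ` T"
    proof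
      show "A \<subseteq> \<phi>' ` T"
      proof
        fix v assume v: "v \<in> A"
        then obtain w where "w \<in> U' \<inter> N" "v = \<phi>' w" using c'(9) unfolding A_def by blast
        then show "v \<in> \<phi>' ` T" using v i' unfolding A_def T_def by auto
      qed
      show "\<phi>' ` T \<subseteq> A"
        using c'(9) i' unfolding A_def T_def by auto
    qed
    then show ?thesis using i' unfolding T_def by (force simp: image_iff)
  qed
  have "open (V' \<inter> \<psi>' -` U)"
    using continuous_open_preimage[OF homeomorphism_cont2[OF c'(4)] c'(3) c(1)] .
  then have opA: "openin (top_of_set S') A"
    unfolding A_def by (auto simp: openin_open)
  have inj: "inj_on (\<phi> \<circ> \<psi>') A"
  proof (rule comp_inj_on)
    show "inj_on \<psi>' A"
      using homeomorphism_apply2[OF c'(4)] unfolding A_def by (intro inj_on_inverseI[of _ \<phi>']) auto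
    show "inj_on \<phi> (\<psi>' ` A)"
      unfolding im T_def using i by (intro inj_on_inverseI[of _ \<psi>]) auto
  qed
  have cont: "continuous_on A (\<phi> \<circ> \<psi>')"
    unfolding A_def
    by (intro continuous_on_compose continuous_on_subset[OF homeomorphism_cont2[OF c'(4)]]
          continuous_on_subset[OF homeomorphism_cont1[OF c(4)]]) auto
  have imf: "(\<phi> \<circ> \<psi>') ` A = \<phi> ` T" unfolding image_comp[symmetric] im ..
  have "\<phi> ` T \<subseteq> S" using c(9) sub unfolding T_def by auto
  then have fs: "\<phi> \<circ> \<psi>' \<in> A \<rightarrow> S" using imf by blast
  have "openin (top_of_set S) (\<phi> ` T)"
    using invariance_of_domain_subspaces[OF opA c'(7) c(7) _ cont fs inj] c(8) c'(8)
    unfolding imf by simp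
  then obtain W where W: "open W" "\<phi> ` T = S \<inter> W" by (auto simp: openin_open)
  have "T = M \<inter> (U \<inter> \<phi> -` W)"
  proof
    show "T \<subseteq> M \<inter> (U \<inter> \<phi> -` W)" using W(2) sub unfolding T_def by blast
    show "M \<inter> (U \<inter> \<phi> -` W) \<subseteq> T"
    proof
      fix w assume w: "w \<in> M \<inter> (U \<inter> \<phi> -` W)"
      then have "\<phi> w \<in> \<phi> ` T" using W(2) c(9) by blast
      then obtain w' where "w' \<in> T" "\<phi> w = \<phi> w'" by blast
      then show "w \<in> T" using i w unfolding T_def by (metis IntD1 IntD2)
    qed
  qed
  moreover have "open (U \<inter> \<phi> -` W)"
    using continuous_open_preimage[OF homeomorphism_cont1[OF c(4)] c(1) W(1)] .
  ultimately have "openin (top_of_set M) T" by (auto simp: openin_open)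
  then show "\<exists>T. openin (top_of_set M) T \<and> n \<in> T \<and> T \<subseteq> N"
    using n c(2) c'(2) unfolding T_def by blast
qed

text \<open>The component of \<open>c\<close> orthogonal to \<open>S\<close> is constant near \<open>0\<close>, so its
  derivative, the orthogonal component of \<open>v\<close>, vanishes.\<close>

lemma has_vector_derivative_in_subspace:
  fixes c :: "real \<Rightarrow> 'a::euclidean_space"
  assumes "(c has_vector_derivative v) (at 0)" "subspace S" "\<forall>\<^sub>F t in nhds 0. c t - c 0 \<in> S"
  shows "v \<in> S"
proof -
  obtain a z where az: "a \<in> S" "\<And>w. w \<in> S \<Longrightarrow> orthogonal z w" "v = a + z"
    using orthogonal_subspace_decomp_exists[of S v] span_eq_iff[of S] assms(2) by metis
  have "((\<lambda>t. z \<bullet> (c t - c 0)) has_real_derivative z \<bullet> v) (at 0)"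
    using assms(1) unfolding has_real_derivative_iff_has_vector_derivative
    by (auto intro!: derivative_eq_intros bounded_linear.has_vector_derivative[OF bounded_linear_inner_right]
         simp: has_vector_derivative_diff_const)
  moreover have "((\<lambda>t. z \<bullet> (c t - c 0)) has_real_derivative 0) (at 0)"
  proof -
    have "\<forall>\<^sub>F t in nhds 0. z \<bullet> (c t - c 0) = 0"
      using assms(3) by eventually_elim (use az(2) in \<open>simp add: orthogonal_def\<close>)
    then show ?thesis by (subst DERIV_cong_ev[OF refl _ refl, of _ "\<lambda>t. 0"]) auto
  qed
  ultimately have "z \<bullet> v = 0" using DERIV_unique by blast
  then have "z = 0" using az by (simp add: inner_add_right orthogonal_def)
  then show ?thesis using az by simp
qed

text \<open>Composition with \<open>f\<close> and with \<open>g\<close> carries curves in \<open>M\<close> and curves in its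
  image into each other, and the chain rule transforms their velocities.  It is applied to
  slice charts and to the straightening map.\<close>

lemma tangent_space_diffeo:
  fixes f :: "'a::euclidean_space \<Rightarrow> 'a"
  assumes U: "open U" "open V" "homeomorphism U V f g" and M: "M \<subseteq> U" "m \<in> M"
    and df: "(f has_derivative f') (at m)" and dg: "(g has_derivative g') (at (f m))"
  shows "tangent_space (f ` M) (f m) = f' ` tangent_space M m" "inj f'"
proof -
  note i1 = homeomorphism_apply1[OF U(3)] and i2 = homeomorphism_apply2[OF U(3)]
  have mU: "m \<in> U" and mV: "f m \<in> V" using M homeomorphism_image1[OF U(3)] by auto
  have c1: "(g \<circ> f has_derivative g' \<circ> f') (at m)" using diff_chain_at[OF df dg] .
  have c1': "(g \<circ> f has_derivative id) (at m)"
    by (rule has_derivative_transform_within_open[OF has_derivative_id U(1) mU]) (simp add: i1)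
  have inv1: "g' (f' v) = v" for v
    using fun_cong[OF has_derivative_unique[OF c1 c1'], of v] by simp
  have c2: "(f \<circ> g has_derivative f' \<circ> g') (at (f m))"
    using diff_chain_at[OF dg] df i1[OF mU] by simp
  have c2': "(f \<circ> g has_derivative id) (at (f m))"
    by (rule has_derivative_transform_within_open[OF has_derivative_id U(2) mV]) (simp add: i2)
  have inv2: "f' (g' v) = v" for v
    using fun_cong[OF has_derivative_unique[OF c2 c2'], of v] by simp
  show "inj f'" by (rule inj_on_inverseI[of _ g']) (rule inv1)
  show "tangent_space (f ` M) (f m) = f' ` tangent_space M m"
  proof (intro equalityI subsetI)
    fix v assume "v \<in> tangent_space (f ` M) (f m)"
    then obtain c where c: "c 0 = f m" "\<forall>\<^sub>F t in nhds 0. c t \<in> f ` M" "(c has_vector_derivative v) (at 0)"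
      unfolding tangent_space_def by blast
    have "(g \<circ> c has_vector_derivative g' v) (at 0)"
      using vector_derivative_diff_chain_within[OF c(3), of g g'] c(1) dg
      by (simp add: has_derivative_at_withinI)
    moreover have "(g \<circ> c) 0 = m" using c(1) i1[OF mU] by simp
    moreover have "\<forall>\<^sub>F t in nhds 0. (g \<circ> c) t \<in> M"
      using c(2) by eventually_elim (use M(1) i1 in auto)
    ultimately have "g' v \<in> tangent_space M m" unfolding tangent_space_def by blast
    then show "v \<in> f' ` tangent_space M m" using inv2[of v] image_eqI[of v f' "g' v"] by simp
  next
    fix w assume "w \<in> f' ` tangent_space M m"
    then obtain v c where w: "w = f' v" and c: "c 0 = m" "\<forall>\<^sub>F t in nhds 0. c t \<in> M" "(c has_vector_derivative v) (at 0)"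
      unfolding tangent_space_def by blast
    have "(f \<circ> c has_vector_derivative w) (at 0)"
      using vector_derivative_diff_chain_within[OF c(3), of f f'] c(1) df w
      by (simp add: has_derivative_at_withinI)
    moreover have "(f \<circ> c) 0 = f m" using c(1) by simp
    moreover have "\<forall>\<^sub>F t in nhds 0. (f \<circ> c) t \<in> f ` M"
      using c(2) by eventually_elim auto
    ultimately show "w \<in> tangent_space (f ` M) (f m)" unfolding tangent_space_def by blast
  qed
qed

lemma tangent_space_Int_open:
  assumes "open U" "m \<in> U"
  shows "tangent_space (U \<inter> M) m = tangent_space M m"
proof -
  have "\<forall>\<^sub>F t in nhds 0. c t \<in> U" if "c 0 = m" "(c has_vector_derivative v) (at 0)" for c v
  proof -
    have "(c \<longlongrightarrow> c 0) (nhds 0)"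
      using has_vector_derivative_continuous[OF that(2)] by (simp add: tendsto_nhds_iff continuous_at)
    then show ?thesis using topological_tendstoD[of c m "nhds 0" U] assms that(1) by simp
  qed
  then show ?thesis
    unfolding tangent_space_def by (auto simp: eventually_conj_iff)
qed

lemma tangent_space_subspace:
  fixes S :: "'a::euclidean_space set"
  assumes S: "subspace S" and m: "m \<in> S"
  shows "tangent_space S m = S"
proof (intro equalityI subsetI)
  fix v assume "v \<in> tangent_space S m"
  then obtain c where c: "c 0 = m" "\<forall>\<^sub>F t in nhds 0. c t \<in> S" "(c has_vector_derivative v) (at 0)"
    unfolding tangent_space_def by blast
  have "\<forall>\<^sub>F t in nhds 0. c t - c 0 \<in> S"
    using c(2) by eventually_elim (use subspace_diff[OF S _ m] c(1) in simp)
  then show "v \<in> S" using has_vector_derivative_in_subspace[OF c(3) S] by simp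
next
  fix v assume v: "v \<in> S"
  have "((\<lambda>t. m + t *\<^sub>R v) has_vector_derivative v) (at 0)"
    by (auto intro!: derivative_eq_intros)
  moreover have "m + t *\<^sub>R v \<in> S" for t
    using S m v by (simp add: subspace_add subspace_scale)
  ultimately show "v \<in> tangent_space S m"
    unfolding tangent_space_def by (intro CollectI exI[of _ "\<lambda>t. m + t *\<^sub>R v"]) simp
qed

lemma tangent_space_submanifold:
  fixes M :: "'a::euclidean_space set"
  assumes M: "submanifold d M" and m: "m \<in> M"
  shows "subspace (tangent_space M m)" "dim (tangent_space M m) = d"
proof -
  obtain U and V :: "'a set" and \<phi> \<psi> S where c: "open U" "m \<in> U" "open V"
    "homeomorphism U V \<phi> \<psi>" "smooth_on U \<phi>" "smooth_on V \<psi>"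
    "subspace S" "dim S = d" "\<phi> ` (U \<inter> M) = V \<inter> S"
    using submanifoldE[OF M m] by blast
  note i1 = homeomorphism_apply1[OF c(4)]
  have mVS: "\<phi> m \<in> V \<inter> S" using c(2,9) m by blast
  have m': "\<psi> (\<phi> m) = m" using i1[OF c(2)] .
  obtain \<phi>' \<psi>' where d1: "(\<phi> has_derivative \<phi>') (at m)" and d2: "(\<psi> has_derivative \<psi>') (at (\<phi> m))"
    using smooth_on_has_derivative[OF c(5,2)] smooth_on_has_derivative[OF c(6)] mVS by blast
  have "\<psi> ` (V \<inter> S) = U \<inter> M"
    unfolding c(9)[symmetric] image_image using i1 by simp
  then have T: "tangent_space M m = \<psi>' ` S" and inj: "inj \<psi>'"
    using tangent_space_diffeo[OF c(3,1) homeomorphism_symD[OF c(4)] Int_lower1 mVS d2, of \<phi>'] d1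
      tangent_space_Int_open[OF c(1,2), of M] tangent_space_Int_open[OF c(3), of "\<phi> m" S]
      tangent_space_subspace[OF c(7), of "\<phi> m"] mVS
    by (simp_all add: m')
  have lin: "linear \<psi>'" using d2 has_derivative_linear by blast
  show "subspace (tangent_space M m)" unfolding T using linear_subspace_image[OF lin c(7)] .
  show "dim (tangent_space M m) = d"
    unfolding T using dim_image_eq[OF lin inj_on_subset[OF inj]] c(8) by simp
qed

text \<open>A geodesic that stays in \<open>S\<close> has a connected image, so it cannot leave the
  component in which it starts.\<close>

lemma totally_geodesic_component:
  assumes tg: "totally_geodesic H g d S"
    and C: "C \<in> components S" and op: "openin (top_of_set S) C"
  shows "totally_geodesic H g d C"
  unfolding totally_geodesic_def
proof (intro conjI allI impI)
  have CS: "C \<subseteq> S" using in_components_subset[OF C] .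
  show "C \<subseteq> H" using CS tg unfolding totally_geodesic_def by blast
  show "submanifold d C"
    using submanifold_openin_subset[OF _ op] tg in_components_nonempty[OF C]
    unfolding totally_geodesic_def by blast
  fix I \<gamma> \<gamma>'
  assume *: "geodesic H g I \<gamma> \<gamma>' \<and>
    (\<exists>t\<in>I. \<gamma> t \<in> C \<and> \<gamma>' t \<in> tangent_space C (\<gamma> t))"
  then obtain t where t: "t \<in> I" "\<gamma> t \<in> C" "\<gamma>' t \<in> tangent_space C (\<gamma> t)" by blast
  have "tangent_space C (\<gamma> t) \<subseteq> tangent_space S (\<gamma> t)"
    unfolding tangent_space_def using CS by (auto elim!: eventually_mono)
  then have "\<gamma> ` I \<subseteq> S"
    using tg * t CS unfolding totally_geodesic_def by blast
  moreover have "connected (\<gamma> ` I)"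
  proof (rule connected_continuous_image)
    show "continuous_on I \<gamma>"
      using * has_vector_derivative_continuous unfolding geodesic_def
      by (intro continuous_at_imp_continuous_on) blast
    show "connected I" using * is_interval_connected unfolding geodesic_def by blast
  qed
  ultimately show "\<gamma> ` I \<subseteq> C"
    using components_maximal[OF C] t by blast
qed

text \<open>A larger connected candidate \<open>N\<close> of the same dimension would contain \<open>M\<close> as an open
  subset (by invariance of domain) and as a closed one, so \<open>M\<close> would be all of \<open>N\<close>.\<close>

lemma maximal_totally_geodesic_if_closed:
  assumes tg: "totally_geodesic H g d M" and con: "connected M" and cl: "closedin (top_of_set H) M"
  shows "maximal_totally_geodesic H g M"
  unfolding maximal_totally_geodesic_def
proof (intro exI[of _ d] conjI tg con notI)
  assume "\<exists>N. totally_geodesic H g d N \<and> connected N \<and> M \<subset> N"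
  then obtain N where N: "totally_geodesic H g d N" "connected N" "M \<subset> N" by blast
  have "openin (top_of_set N) M"
    using submanifold_openin_of_subset tg N(1,3) unfolding totally_geodesic_def by blast
  moreover have "closedin (top_of_set N) M"
    using closedin_subset_trans[OF cl, of N] N(1,3) unfolding totally_geodesic_def by blast
  moreover have "M \<noteq> {}" using tg unfolding totally_geodesic_def submanifold_def by blast
  ultimately show False using N(2,3) unfolding connected_clopen by blast
qed

section \<open>Geodesics of the half-space\<close>

text \<open>The diagonal entry, up to the factor \<open>1 / z\<^sup>2\<close>, of the half-space metric.\<close>

definition signature_sign :: "'n set \<Rightarrow> 'n \<Rightarrow> real" where
  "signature_sign Y i = (if i \<in> Y then - 1 else 1)"

text \<open>The flat pseudo-Euclidean scalar product of the boundary hyperplane, applied to the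
  horizontal parts of two vectors; their coordinates of index \<open>k\<close> are ignored.  In comments it is
  written \<open>\<langle>v, w\<rangle>\<close>.\<close>

definition horizontal_form :: "'n::finite set \<Rightarrow> 'n \<Rightarrow> real ^ 'n \<Rightarrow> real ^ 'n \<Rightarrow> real" where
  "horizontal_form Y k v w = (\<Sum>i\<in>-{k}. signature_sign Y i * v $ i * w $ i)"

lemma half_space_metric_entry:
  assumes "half_space_coordinates p q X Y k"
  shows "half_space_metric X Y k w $ i $ j = (if i = j then signature_sign Y i / (w $ k)\<^sup>2 else 0)"
  using assms unfolding half_space_coordinates_def half_space_metric_def signature_sign_def by auto

lemma matrix_inv_half_space_metric:
  assumes hs: "half_space_coordinates p q X Y k" and w: "w $ k > 0"
  shows "matrix_inv (half_space_metric X Y k w) $ i $ j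
           = (if i = j then signature_sign Y i * (w $ k)\<^sup>2 else 0)"
proof -
  define B where "B = (\<chi> i j. if i = j then signature_sign Y i * (w $ k)\<^sup>2 else 0)"
  have s: "signature_sign Y i * signature_sign Y i = 1" for i by (simp add: signature_sign_def)
  have "half_space_metric X Y k w ** B = mat 1" "B ** half_space_metric X Y k w = mat 1"
    using w unfolding B_def
    by (simp_all add: vec_eq_iff matrix_matrix_mult_def mat_def half_space_metric_entry[OF hs]
        if_distrib[of "\<lambda>x. x * _"] if_distrib[of "\<lambda>x. _ * x"] s cong: if_cong)
  then have "matrix_inv (half_space_metric X Y k w) = B"
    unfolding matrix_inv_def
    by (intro some_equality conjI) (auto, metis matrix_mul_assoc matrix_mul_lid matrix_mul_rid)
  then show ?thesis by (simp add: B_def)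
qed

lemma partial_derivative_half_space_metric:
  assumes hs: "half_space_coordinates p q X Y k" and w: "w $ k > 0"
  shows "partial_derivative j (\<lambda>u. half_space_metric X Y k u $ m $ l) w
           = (if m = l then if j = k then - 2 * signature_sign Y m / (w $ k) ^ 3 else 0 else 0)"
proof -
  have "((\<lambda>u. signature_sign Y m / (u $ k)\<^sup>2) has_derivative
          (\<lambda>h. - 2 * signature_sign Y m * h $ k / (w $ k) ^ 3)) (at w)"
    using w by (auto intro!: derivative_eq_intros bounded_linear.has_derivative[OF bounded_linear_vec_nth]
        simp: field_simps power2_eq_square power3_eq_cube)
  then have fd: "frechet_derivative (\<lambda>u. signature_sign Y m / (u $ k)\<^sup>2) (at w)
      = (\<lambda>h. - 2 * signature_sign Y m * h $ k / (w $ k) ^ 3)"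
    by (rule frechet_derivative_at[symmetric])
  show ?thesis
  proof (cases "m = l")
    case True
    with fd show ?thesis
      unfolding partial_derivative_def half_space_metric_entry[OF hs] by (simp add: axis_def)
  next
    case False
    then show ?thesis
      unfolding partial_derivative_def half_space_metric_entry[OF hs]
      by (simp add: frechet_derivative_const)
  qed
qed

lemma christoffel_half_space:
  assumes hs: "half_space_coordinates p q X Y k" and w: "w $ k > 0"
  shows "christoffel (half_space_metric X Y k) w i j l =
     - (1 / w $ k) * ((if j = k then 1 else 0) * (if l = i then 1 else 0)
        + (if l = k then 1 else 0) * (if j = i then 1 else 0)
        - (if i = k then 1 else 0) * (if l = j then signature_sign Y j else 0))"
proof -
  have s: "signature_sign Y i * signature_sign Y i = 1" for i by (simp add: signature_sign_def)
  have k: "signature_sign Y k = 1"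
    using hs by (simp add: signature_sign_def half_space_coordinates_def)
  show ?thesis
    unfolding christoffel_def partial_derivative_half_space_metric[OF hs w] matrix_inv_half_space_metric[OF hs w]
    apply (simp add: if_distrib[of "\<lambda>x. x * _"] cong: if_cong)
    using w s[of i] k by (auto simp: field_simps power2_eq_square power3_eq_cube)
qed

lemma geodesic_term_half_space:
  fixes v :: "real ^ 'n::finite"
  assumes hs: "half_space_coordinates p q X Y k" and w: "w $ k > 0"
  shows "(\<Sum>j\<in>UNIV. \<Sum>l\<in>UNIV. christoffel (half_space_metric X Y k) w i j l * v $ j * v $ l)
    = - ((2 * v $ k * v $ i - (if i = k then (v $ k)\<^sup>2 + horizontal_form Y k v v else 0)) / w $ k)"
proof -
  have k: "signature_sign Y k = 1"
    using hs by (simp add: signature_sign_def half_space_coordinates_def)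
  \<comment> \<open>the three groups of Kronecker symbols are summed separately\<close>
  have "(\<Sum>j\<in>UNIV. \<Sum>l\<in>UNIV. christoffel (half_space_metric X Y k) w i j l * v $ j * v $ l)
     = - (1 / w $ k) * ((\<Sum>j\<in>UNIV. \<Sum>l\<in>UNIV. (if j = k then v $ j else 0) * (if l = i then v $ l else 0))
        + (\<Sum>j\<in>UNIV. \<Sum>l\<in>UNIV. (if l = k then v $ l else 0) * (if j = i then v $ j else 0))
        - (if i = k then 1 else 0) * (\<Sum>j\<in>UNIV. \<Sum>l\<in>UNIV. (if l = j then signature_sign Y j * v $ j * v $ l else 0)))"
    unfolding christoffel_half_space[OF hs w] sum_distrib_left sum.distrib[symmetric] sum_subtractf[symmetric]
    by (intro sum.cong refl) (auto simp: algebra_simps)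
  also have "\<dots> = - (1 / w $ k) * (v $ k * v $ i + v $ k * v $ i
       - (if i = k then 1 else 0) * (\<Sum>j\<in>UNIV. signature_sign Y j * v $ j * v $ j))"
    by (simp add: sum_distrib_left[symmetric] sum_distrib_right[symmetric])
  also have "(\<Sum>j\<in>UNIV. signature_sign Y j * v $ j * v $ j) = (v $ k)\<^sup>2 + horizontal_form Y k v v"
    unfolding horizontal_form_def
    by (subst sum.remove[of UNIV k]) (simp_all add: k power2_eq_square Compl_eq_Diff_UNIV)
  finally show ?thesis by (auto simp: algebra_simps diff_divide_distrib add_divide_distrib)
qed

text \<open>With \<open>u\<close> the horizontal part and \<open>z\<close> the height of a curve, the equations read
  \<open>u'' = 2 u' z' / z\<close> and \<open>z'' = (z'\<^sup>2 - \<langle>u', u'\<rangle>) / z\<close>.  In the formula below, the summand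
  \<open>(z')\<^sup>2\<close> subtracted for \<open>i = k\<close> turns the generic \<open>2 z' z'\<close> into \<open>z'\<^sup>2\<close>.\<close>

lemma geodesic_half_space_iff:
  assumes hs: "half_space_coordinates p q X Y k"
  shows "geodesic (half_space k) (half_space_metric X Y k) I \<gamma> \<gamma>' \<longleftrightarrow>
    open I \<and> is_interval I \<and> (\<forall>t\<in>I. \<gamma> t $ k > 0) \<and>
    (\<exists>\<gamma>''. \<forall>t\<in>I. (\<gamma> has_vector_derivative \<gamma>' t) (at t) \<and> (\<gamma>' has_vector_derivative \<gamma>'' t) (at t) \<and>
      (\<forall>i. \<gamma>'' t $ i = (2 * \<gamma>' t $ k * \<gamma>' t $ i
         - (if i = k then (\<gamma>' t $ k)\<^sup>2 + horizontal_form Y k (\<gamma>' t) (\<gamma>' t) else 0)) / \<gamma> t $ k))"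
proof -
  have eq: "(\<forall>i. a $ i + (\<Sum>j\<in>UNIV. \<Sum>l\<in>UNIV. christoffel (half_space_metric X Y k) w i j l * v $ j * v $ l) = 0)
    \<longleftrightarrow> (\<forall>i. a $ i = (2 * v $ k * v $ i
         - (if i = k then (v $ k)\<^sup>2 + horizontal_form Y k v v else 0)) / w $ k)"
    if "w $ k > 0" for a v w
    unfolding geodesic_term_half_space[OF hs that] by simp
  have H: "\<gamma> ` I \<subseteq> half_space k \<longleftrightarrow> (\<forall>t\<in>I. \<gamma> t $ k > 0)" by (auto simp: half_space_def)
  show ?thesis unfolding geodesic_def H
    by (intro conj_cong refl ex_cong1 ball_cong) (simp add: eq)
qed

section \<open>Straight coordinates\<close>

lemma horizontal_form_simps:
  "horizontal_form Y k (u + v) w = horizontal_form Y k u w + horizontal_form Y k v w"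
  "horizontal_form Y k w (u + v) = horizontal_form Y k w u + horizontal_form Y k w v"
  "horizontal_form Y k (r *\<^sub>R v) w = r * horizontal_form Y k v w"
  "horizontal_form Y k w (r *\<^sub>R v) = r * horizontal_form Y k w v"
  unfolding horizontal_form_def
  by (simp_all add: algebra_simps sum.distrib sum_distrib_left)

lemma horizontal_form_commute: "horizontal_form Y k v w = horizontal_form Y k w v"
  unfolding horizontal_form_def by (simp add: mult_ac)

lemma horizontal_form_cong:
  assumes "\<And>i. i \<noteq> k \<Longrightarrow> v $ i = v' $ i" "\<And>i. i \<noteq> k \<Longrightarrow> w $ i = w' $ i"
  shows "horizontal_form Y k v w = horizontal_form Y k v' w'"
  unfolding horizontal_form_def by (intro sum.cong) (auto simp: assms)

text \<open>The change of coordinates \<open>(u, z) \<mapsto> (u, z\<^sup>2 + \<langle>u, u\<rangle>)\<close>.  It is the affine chart of the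
  projective (Klein) model: it takes unparametrised geodesics to straight segments, vertical subspaces
  to affine subspaces containing the vertical direction, and quadrics to affine hyperplanes.\<close>

definition straighten :: "'n::finite set \<Rightarrow> 'n \<Rightarrow> real ^ 'n \<Rightarrow> real ^ 'n" where
  "straighten Y k w = w + ((w $ k)\<^sup>2 + horizontal_form Y k w w - w $ k) *\<^sub>R axis k 1"

definition unstraighten :: "'n::finite set \<Rightarrow> 'n \<Rightarrow> real ^ 'n \<Rightarrow> real ^ 'n" where
  "unstraighten Y k v = v + (sqrt (v $ k - horizontal_form Y k v v) - v $ k) *\<^sub>R axis k 1"

definition straight_domain :: "'n::finite set \<Rightarrow> 'n \<Rightarrow> (real ^ 'n) set" where
  "straight_domain Y k = {v. horizontal_form Y k v v < v $ k}"

lemma straighten_nth: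
  "straighten Y k w $ i = (if i = k then (w $ k)\<^sup>2 + horizontal_form Y k w w else w $ i)"
  by (simp add: straighten_def axis_def)

lemma unstraighten_nth:
  "unstraighten Y k v $ i = (if i = k then sqrt (v $ k - horizontal_form Y k v v) else v $ i)"
  by (simp add: unstraighten_def axis_def)

lemma horizontal_form_straighten [simp]:
  "horizontal_form Y k (straighten Y k v) (straighten Y k w) = horizontal_form Y k v w"
  by (rule horizontal_form_cong) (simp_all add: straighten_nth)

lemma horizontal_form_unstraighten [simp]:
  "horizontal_form Y k (unstraighten Y k v) (unstraighten Y k w) = horizontal_form Y k v w"
  by (rule horizontal_form_cong) (simp_all add: unstraighten_nth)

lemma unstraighten_straighten: "w \<in> half_space k \<Longrightarrow> unstraighten Y k (straighten Y k w) = w"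
  by (simp add: vec_eq_iff unstraighten_nth straighten_nth half_space_def)

lemma straighten_unstraighten: "v \<in> straight_domain Y k \<Longrightarrow> straighten Y k (unstraighten Y k v) = v"
  by (simp add: vec_eq_iff unstraighten_nth straighten_nth straight_domain_def)

lemma straighten_in_domain: "w \<in> half_space k \<Longrightarrow> straighten Y k w \<in> straight_domain Y k"
  by (simp add: straight_domain_def straighten_nth half_space_def)

lemma unstraighten_in_half_space: "v \<in> straight_domain Y k \<Longrightarrow> unstraighten Y k v \<in> half_space k"
  by (simp add: straight_domain_def unstraighten_nth half_space_def)

lemma open_half_space: "open (half_space k)"
  unfolding half_space_def by (intro open_Collect_less continuous_intros)

lemma continuous_on_horizontal_form [continuous_intros]:
  "continuous_on S f \<Longrightarrow> continuous_on S g \<Longrightarrow> continuous_on S (\<lambda>x. horizontal_form Y k (f x) (g x))"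
  unfolding horizontal_form_def by (intro continuous_intros)

lemma open_straight_domain: "open (straight_domain Y k)"
  unfolding straight_domain_def by (intro open_Collect_less continuous_intros)

lemma homeomorphism_straighten:
  "homeomorphism (half_space k) (straight_domain Y k) (straighten Y k) (unstraighten Y k)"
proof (rule homeomorphismI)
  show "continuous_on (half_space k) (straighten Y k)"
    unfolding straighten_def by (intro continuous_intros)
  show "continuous_on (straight_domain Y k) (unstraighten Y k)"
    unfolding unstraighten_def by (intro continuous_intros)
qed (auto simp: straighten_in_domain unstraighten_in_half_space unstraighten_straighten straighten_unstraighten)

text \<open>The translation by \<open>e\<close> is there because a slice chart has to take values in a linear,
  not an affine, subspace.\<close>

lemma smooth_on_straighten:
  assumes "open U"
  shows "smooth_on U (\<lambda>w. straighten Y k w - e)"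
proof -
  have "Ck_on n U (\<lambda>w. w + ((w $ k * w $ k + (\<Sum>i\<in>-{k}. (signature_sign Y i * w $ i) * w $ i))
      + (- 1) * w $ k) *\<^sub>R axis k 1 + (- e))" for n
    by (intro Ck_on_add Ck_on_scaleR Ck_on_mult Ck_on_sum Ck_on_const assms
        Ck_on_bounded_linear[OF assms bounded_linear_ident]
        Ck_on_bounded_linear[OF assms bounded_linear_vec_nth])
  then show ?thesis
    unfolding smooth_on_def straighten_def horizontal_form_def by (simp add: power2_eq_square)
qed

lemma smooth_on_unstraighten:
  assumes "open U" "\<And>v. v \<in> U \<Longrightarrow> v + e \<in> straight_domain Y k"
  shows "smooth_on U (\<lambda>v. unstraighten Y k (v + e))"
proof -
  have nth: "Ck_on n U (\<lambda>v. v $ i + e $ i)" for n i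
    by (intro Ck_on_add Ck_on_const assms Ck_on_bounded_linear[OF assms(1) bounded_linear_vec_nth])
  have "Ck_on n U (\<lambda>v. ((v $ k + e $ k)
      + (- 1) * (\<Sum>i\<in>-{k}. (signature_sign Y i * (v $ i + e $ i)) * (v $ i + e $ i))) powr (1/2))" for n
  proof (rule Ck_on_powr[OF assms(1)])
    show "Ck_on n U (\<lambda>v. (v $ k + e $ k)
      + (- 1) * (\<Sum>i\<in>-{k}. (signature_sign Y i * (v $ i + e $ i)) * (v $ i + e $ i)))"
      by (intro Ck_on_add Ck_on_mult Ck_on_sum Ck_on_const nth assms(1))
    show "0 < (x $ k + e $ k) + (- 1) * (\<Sum>i\<in>-{k}. (signature_sign Y i * (x $ i + e $ i)) * (x $ i + e $ i))"
      if "x \<in> U" for x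
      using assms(2)[OF that] by (simp add: straight_domain_def horizontal_form_def)
  qed
  then have "Ck_on n U (\<lambda>v. (v + e) + (((v $ k + e $ k)
      + (- 1) * (\<Sum>i\<in>-{k}. (signature_sign Y i * (v $ i + e $ i)) * (v $ i + e $ i))) powr (1/2)
      + (- 1) * (v $ k + e $ k)) *\<^sub>R axis k 1)" for n
    by (intro Ck_on_add[OF assms(1)] Ck_on_scaleR[OF assms(1)] Ck_on_mult[OF assms(1)] assms(1) nth
        Ck_on_const Ck_on_bounded_linear[OF assms(1) bounded_linear_ident])
  moreover have "unstraighten Y k (v + e) = (v + e) + (((v $ k + e $ k)
      + (- 1) * (\<Sum>i\<in>-{k}. (signature_sign Y i * (v $ i + e $ i)) * (v $ i + e $ i))) powr (1/2)
      + (- 1) * (v $ k + e $ k)) *\<^sub>R axis k 1" if "v \<in> U" for v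
    using assms(2)[OF that]
    by (simp add: unstraighten_def straight_domain_def horizontal_form_def powr_half_sqrt)
  ultimately show ?thesis
    unfolding smooth_on_def by (metis (no_types, lifting) Ck_on_cong[OF assms(1)])
qed

section \<open>Geodesics in straight coordinates\<close>

lemma has_vector_derivative_vec_iff:
  fixes f :: "real \<Rightarrow> real ^ 'n::finite"
  shows "(f has_vector_derivative f') (at a) \<longleftrightarrow>
    (\<forall>i. ((\<lambda>t. f t $ i) has_vector_derivative f' $ i) (at a))"
  unfolding has_vector_derivative_def has_derivative_componentwise_within[of f _ a UNIV]
  by (auto simp: Basis_vec_def inner_axis)

lemma has_real_derivative_horizontal_form:
  assumes "(f has_vector_derivative f') (at t)" "(g has_vector_derivative g') (at t)"
  shows "((\<lambda>t. horizontal_form Y k (f t) (g t)) has_real_derivative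
           horizontal_form Y k f' (g t) + horizontal_form Y k (f t) g') (at t)"
proof -
  have "((\<lambda>t. f t $ i) has_real_derivative f' $ i) (at t)" "((\<lambda>t. g t $ i) has_real_derivative g' $ i) (at t)" for i
    using assms unfolding has_vector_derivative_vec_iff has_real_derivative_iff_has_vector_derivative by auto
  note [derivative_intros] = this
  show ?thesis unfolding horizontal_form_def
    by (auto intro!: derivative_eq_intros simp: sum.distrib[symmetric] algebra_simps intro!: sum.cong)
qed

text \<open>The component of the curve orthogonal to \<open>S\<close> has derivative zero on the interval.\<close>

lemma curve_diff_in_subspace:
  fixes c :: "real \<Rightarrow> 'a::euclidean_space"
  assumes "is_interval I" "subspace S"
    and der: "\<And>t. t \<in> I \<Longrightarrow> (c has_vector_derivative c' t) (at t)" "\<And>t. t \<in> I \<Longrightarrow> c' t \<in> S"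
    and st: "s \<in> I" "t \<in> I"
  shows "c t - c s \<in> S"
proof -
  obtain a z where az: "a \<in> S" "\<And>w. w \<in> S \<Longrightarrow> orthogonal z w" "c t - c s = a + z"
    using orthogonal_subspace_decomp_exists[of S "c t - c s"] span_eq_iff[of S] assms(2) by metis
  have "((\<lambda>t. z \<bullet> c t) has_derivative (\<lambda>h. 0)) (at u within I)" if "u \<in> I" for u
  proof -
    have "z \<bullet> c' u = 0" using az(2) der(2) that by (simp add: orthogonal_def)
    moreover have "((\<lambda>t. z \<bullet> c t) has_vector_derivative z \<bullet> c' u) (at u)"
      using bounded_linear.has_vector_derivative[OF bounded_linear_inner_right der(1)[OF that]] .
    ultimately show ?thesis
      by (simp add: has_vector_derivative_def has_derivative_at_withinI)
  qed
  then obtain r where "\<forall>u\<in>I. z \<bullet> c u = r"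
    using has_derivative_zero_constant[of I "\<lambda>t. z \<bullet> c t"] is_interval_convex[OF assms(1)] by blast
  then have "z \<bullet> (c t - c s) = 0" using st by (simp add: inner_diff_right)
  then have "z = 0" using az by (simp add: inner_add_right orthogonal_def)
  then show ?thesis using az by simp
qed

lemma has_vector_derivative_straighten:
  assumes "(\<gamma> has_vector_derivative v) (at t)"
  shows "((\<lambda>t. straighten Y k (\<gamma> t)) has_vector_derivative
     (\<chi> i. if i = k then 2 * (\<gamma> t $ k * v $ k + horizontal_form Y k (\<gamma> t) v) else v $ i)) (at t)"
proof -
  have nth: "((\<lambda>t. \<gamma> t $ i) has_real_derivative v $ i) (at t)" for i
    using assms unfolding has_vector_derivative_vec_iff has_real_derivative_iff_has_vector_derivative by auto
  note [derivative_intros] = nth has_real_derivative_horizontal_form[OF assms assms]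
  have "((\<lambda>t. (\<gamma> t $ k)\<^sup>2 + horizontal_form Y k (\<gamma> t) (\<gamma> t)) has_real_derivative
      2 * (\<gamma> t $ k * v $ k + horizontal_form Y k (\<gamma> t) v)) (at t)"
    by (auto intro!: derivative_eq_intros simp: horizontal_form_commute[of Y k v])
  then show ?thesis
    using nth unfolding has_vector_derivative_vec_iff has_real_derivative_iff_has_vector_derivative
    by (simp add: straighten_nth)
qed

text \<open>The metric is invariant under horizontal translations and under dilations of the
  half-space; the associated first integrals of the geodesic flow are
  \<open>u' / z\<^sup>2\<close> and \<open>z' / z + \<langle>u, u'\<rangle> / z\<^sup>2\<close>.  Up to a factor \<open>2\<close> in the last one they are the
  coordinates of \<open>(straighten \<circ> \<gamma>)' / z\<^sup>2\<close>, so this vector is constant and the image curve runs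
  along a straight line.\<close>

lemma geodesic_straighten_velocity:
  assumes hs: "half_space_coordinates p q X Y k"
    and geo: "geodesic (half_space k) (half_space_metric X Y k) I \<gamma> \<gamma>'"
  shows "\<exists>A. \<forall>t\<in>I. ((\<lambda>t. straighten Y k (\<gamma> t)) has_vector_derivative (\<gamma> t $ k)\<^sup>2 *\<^sub>R A) (at t)"
proof -
  obtain \<gamma>'' where I: "open I" "is_interval I" and pos: "\<And>t. t \<in> I \<Longrightarrow> \<gamma> t $ k > 0"
    and d1: "\<And>t. t \<in> I \<Longrightarrow> (\<gamma> has_vector_derivative \<gamma>' t) (at t)"
    and d2: "\<And>t. t \<in> I \<Longrightarrow> (\<gamma>' has_vector_derivative \<gamma>'' t) (at t)"
    and eq: "\<And>t i. t \<in> I \<Longrightarrow> \<gamma>'' t $ i = (2 * \<gamma>' t $ k * \<gamma>' t $ i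
         - (if i = k then (\<gamma>' t $ k)\<^sup>2 + horizontal_form Y k (\<gamma>' t) (\<gamma>' t) else 0)) / \<gamma> t $ k"
    using geo unfolding geodesic_half_space_iff[OF hs] by blast
  \<comment> \<open>the velocity of the straightened curve, divided by \<open>z\<^sup>2\<close>\<close>
  define M where "M t = (\<chi> i. if i = k then 2 * (\<gamma>' t $ k / \<gamma> t $ k
     + horizontal_form Y k (\<gamma> t) (\<gamma>' t) / (\<gamma> t $ k)\<^sup>2) else \<gamma>' t $ i / (\<gamma> t $ k)\<^sup>2)" for t
  have dM: "(M has_vector_derivative 0) (at t)" if t: "t \<in> I" for t
    unfolding has_vector_derivative_vec_iff has_real_derivative_iff_has_vector_derivative[symmetric]
  proof
    fix i
    have n1: "((\<lambda>t. \<gamma> t $ i) has_real_derivative \<gamma>' t $ i) (at t)" for i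
      using d1[OF t] unfolding has_vector_derivative_vec_iff has_real_derivative_iff_has_vector_derivative by auto
    have n2: "((\<lambda>t. \<gamma>' t $ i) has_real_derivative \<gamma>'' t $ i) (at t)" for i
      using d2[OF t] unfolding has_vector_derivative_vec_iff has_real_derivative_iff_has_vector_derivative by auto
    note [derivative_intros] = n1 n2 has_real_derivative_horizontal_form[OF d1[OF t] d2[OF t]]
    have z: "\<gamma> t $ k > 0" using pos t by blast
    have h: "horizontal_form Y k (\<gamma> t) (\<gamma>'' t) = 2 * \<gamma>' t $ k / \<gamma> t $ k * horizontal_form Y k (\<gamma> t) (\<gamma>' t)"
      unfolding horizontal_form_simps(4)[symmetric]
      by (rule horizontal_form_cong) (simp_all add: eq[OF t])
    show "((\<lambda>t. M t $ i) has_real_derivative 0 $ i) (at t)"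
    proof (cases "i = k")
      case True
      have "((\<lambda>t. 2 * (\<gamma>' t $ k / \<gamma> t $ k + horizontal_form Y k (\<gamma> t) (\<gamma>' t) / (\<gamma> t $ k)\<^sup>2))
          has_real_derivative 0) (at t)"
        using z by (auto intro!: derivative_eq_intros simp: h eq[OF t] field_simps power2_eq_square)
      then show ?thesis by (simp add: M_def True)
    next
      case False
      have "((\<lambda>t. \<gamma>' t $ i / (\<gamma> t $ k)\<^sup>2) has_real_derivative 0) (at t)"
        using z False by (auto intro!: derivative_eq_intros simp: eq[OF t] field_simps power2_eq_square)
      then show ?thesis by (simp add: M_def False)
    qed
  qed
  have "\<exists>A. \<forall>t\<in>I. M t = A"
    by (rule has_derivative_zero_constant[OF is_interval_convex[OF I(2)]])
       (use dM in \<open>simp add: has_vector_derivative_def has_derivative_at_withinI\<close>)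
  then obtain A where A: "\<And>t. t \<in> I \<Longrightarrow> M t = A" by blast
  show ?thesis
  proof (intro exI[of _ A] ballI)
    fix t assume t: "t \<in> I"
    have "(\<chi> i. if i = k then 2 * (\<gamma> t $ k * \<gamma>' t $ k + horizontal_form Y k (\<gamma> t) (\<gamma>' t)) else \<gamma>' t $ i)
        = (\<gamma> t $ k)\<^sup>2 *\<^sub>R A"
      using pos[OF t] unfolding A[OF t, symmetric] M_def
      by (simp add: vec_eq_iff field_simps power2_eq_square)
    then show "((\<lambda>t. straighten Y k (\<gamma> t)) has_vector_derivative (\<gamma> t $ k)\<^sup>2 *\<^sub>R A) (at t)"
      using has_vector_derivative_straighten[OF d1[OF t], of Y k] by simp
  qed
qed

text \<open>The converse: on the straight side, the speed at a point \<open>v\<close> has to be proportional to the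
  squared height \<open>z\<^sup>2 = v\<^sub>k - \<langle>v, v\<rangle>\<close> of the corresponding point of the half-space.\<close>

lemma geodesic_unstraighten:
  assumes hs: "half_space_coordinates p q X Y k"
    and I: "open I" "is_interval I"
    and dom: "\<And>t. t \<in> I \<Longrightarrow> c t \<in> straight_domain Y k"
    and dc: "\<And>t. t \<in> I \<Longrightarrow>
      (c has_vector_derivative (c t $ k - horizontal_form Y k (c t) (c t)) *\<^sub>R A) (at t)"
  shows "\<exists>\<gamma>'. geodesic (half_space k) (half_space_metric X Y k) I (\<lambda>t. unstraighten Y k (c t)) \<gamma>'"
proof -
  define \<gamma> where "\<gamma> t = unstraighten Y k (c t)" for t
  define r where "r t = c t $ k - horizontal_form Y k (c t) (c t)" for t
  \<comment> \<open>\<open>r\<close> is the squared height along the curve, and \<open>l\<close> is the logarithmic derivative of the height\<close>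
  define l where "l t = A $ k / 2 - horizontal_form Y k (c t) A" for t
  define \<gamma>' where "\<gamma>' t = (\<chi> i. if i = k then sqrt (r t) * l t else r t * A $ i)" for t
  define \<gamma>'' where "\<gamma>'' t = (\<chi> i. if i = k then sqrt (r t) * (l t)\<^sup>2 - sqrt (r t) * r t * horizontal_form Y k A A
     else 2 * r t * l t * A $ i)" for t
  have rpos: "r t > 0" if "t \<in> I" for t using dom[OF that] by (simp add: straight_domain_def r_def)
  have dr: "(r has_real_derivative 2 * r t * l t) (at t)"
    and dl: "(l has_real_derivative - r t * horizontal_form Y k A A) (at t)"
    and ds: "((\<lambda>t. sqrt (r t)) has_real_derivative sqrt (r t) * l t) (at t)"
    and dn: "((\<lambda>t. c t $ i) has_real_derivative r t * A $ i) (at t)"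
    if t: "t \<in> I" for t i
  proof -
    have n: "((\<lambda>t. c t $ i) has_real_derivative r t * A $ i) (at t)" for i
      using dc[OF t] unfolding has_vector_derivative_vec_iff has_real_derivative_iff_has_vector_derivative r_def by auto
    then show "((\<lambda>t. c t $ i) has_real_derivative r t * A $ i) (at t)" .
    note [derivative_intros] = n has_real_derivative_horizontal_form[OF dc[OF t] dc[OF t]]
      has_real_derivative_horizontal_form[OF dc[OF t] has_vector_derivative_const]
    show dr: "(r has_real_derivative 2 * r t * l t) (at t)"
      using DERIV_diff[OF n[of k] has_real_derivative_horizontal_form[OF dc[OF t] dc[OF t], of Y k]]
      unfolding r_def[symmetric] l_def
      by (simp add: horizontal_form_simps horizontal_form_commute[of Y k A] algebra_simps)
    show "(l has_real_derivative - r t * horizontal_form Y k A A) (at t)"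
      unfolding l_def[abs_def]
      by (auto intro!: derivative_eq_intros simp: r_def[symmetric] horizontal_form_simps)
         (simp add: horizontal_form_def)
    show "((\<lambda>t. sqrt (r t)) has_real_derivative sqrt (r t) * l t) (at t)"
      using rpos[OF t] real_sqrt_pow2[of "r t"]
      by (auto intro!: derivative_eq_intros dr simp: field_simps power2_eq_square)
  qed
  have "geodesic (half_space k) (half_space_metric X Y k) I \<gamma> \<gamma>'"
    unfolding geodesic_half_space_iff[OF hs]
  proof (intro conjI I ballI exI[of _ \<gamma>''] allI)
    fix t assume t: "t \<in> I"
    note r = rpos[OF t]
    have gk: "\<gamma> t $ k = sqrt (r t)" by (simp add: \<gamma>_def unstraighten_nth r_def)
    show "\<gamma> t $ k > 0" using r gk by simp
    show "(\<gamma> has_vector_derivative \<gamma>' t) (at t)"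
      unfolding has_vector_derivative_vec_iff has_real_derivative_iff_has_vector_derivative[symmetric]
        \<gamma>_def[abs_def] unstraighten_nth \<gamma>'_def
      using dn[OF t] ds[OF t] by (simp add: r_def[symmetric])
    show "(\<gamma>' has_vector_derivative \<gamma>'' t) (at t)"
      unfolding has_vector_derivative_vec_iff has_real_derivative_iff_has_vector_derivative[symmetric]
    proof
      fix i
      note [derivative_intros] = dr[OF t] dl[OF t] ds[OF t]
      show "((\<lambda>t. \<gamma>' t $ i) has_real_derivative \<gamma>'' t $ i) (at t)"
        unfolding \<gamma>'_def \<gamma>''_def
        by (cases "i = k") (auto intro!: derivative_eq_intros simp: algebra_simps power2_eq_square)
    qed
    have h: "horizontal_form Y k (\<gamma>' t) (\<gamma>' t) = (r t)\<^sup>2 * horizontal_form Y k A A"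
    proof -
      have "horizontal_form Y k (\<gamma>' t) (\<gamma>' t) = horizontal_form Y k (r t *\<^sub>R A) (r t *\<^sub>R A)"
        by (rule horizontal_form_cong) (simp_all add: \<gamma>'_def)
      then show ?thesis by (simp add: horizontal_form_simps power2_eq_square)
    qed
    obtain s where s: "s > 0" "r t = s\<^sup>2" "sqrt (r t) = s"
      using r by (metis real_sqrt_gt_zero real_sqrt_pow2 less_imp_le)
    show "\<gamma>'' t $ i = (2 * \<gamma>' t $ k * \<gamma>' t $ i
         - (if i = k then (\<gamma>' t $ k)\<^sup>2 + horizontal_form Y k (\<gamma>' t) (\<gamma>' t) else 0)) / \<gamma> t $ k" for i
      unfolding h gk s(3) unfolding \<gamma>'_def \<gamma>''_def
      using s(1) by (auto simp: s(2,3) field_simps power2_eq_square)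
  qed
  then show ?thesis unfolding \<gamma>_def by blast
qed

text \<open>The solution of \<open>s' = P s\<close> is the inverse function of an antiderivative of \<open>1 / P\<close>; it
  runs from \<open>0\<close> to \<open>1\<close> in finite time because \<open>P\<close> is positive on a neighbourhood of the whole
  interval.  One argument covers segments that are spacelike, timelike or lightlike, for which explicit
  formulas would differ.\<close>

lemma autonomous_ode_solution_through_0_1:
  fixes P :: "real \<Rightarrow> real"
  assumes cont: "continuous_on UNIV P" and pos: "\<And>s. 0 \<le> s \<Longrightarrow> s \<le> 1 \<Longrightarrow> P s > 0"
  obtains I s t0 t1 where "open I" "is_interval I" "t0 \<in> I" "t1 \<in> I" "s t0 = 0" "s t1 = 1"
    "\<And>t. t \<in> I \<Longrightarrow> P (s t) > 0 \<and> (s has_real_derivative P (s t)) (at t)"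
proof -
  have opn: "open {s. P s > 0}" using cont by (intro open_Collect_less) auto
  obtain e1 where e1: "e1 > 0" "ball 0 e1 \<subseteq> {s. P s > 0}"
    using openE[OF opn, of 0] pos by auto
  obtain e2 where e2: "e2 > 0" "ball 1 e2 \<subseteq> {s. P s > 0}"
    using openE[OF opn, of 1] pos by auto
  define e where "e = min e1 e2 / 2"
  have e: "e > 0" using e1 e2 by (simp add: e_def)
  have Ppos: "P s > 0" if "s \<in> {-e..1+e}" for s
  proof -
    consider "s < 0" | "0 \<le> s" "s \<le> 1" | "s > 1" by linarith
    then show ?thesis
    proof cases
      case 1
      then have "s \<in> ball 0 e1" using that e1 e2 by (auto simp: dist_real_def e_def)
      then show ?thesis using e1 by blast
    next
      case 3
      then have "s \<in> ball 1 e2" using that e1 e2 by (auto simp: dist_real_def e_def)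
      then show ?thesis using e2 by blast
    qed (use pos in auto)
  qed
  have "continuous_on {-e..1+e} (\<lambda>s. 1 / P s)"
  proof (intro continuous_intros continuous_on_subset[OF cont])
    show "\<forall>s\<in>{-e..1+e}. P s \<noteq> 0" using Ppos by force
  qed auto
  then obtain F where F: "\<And>s. s \<in> {-e..1+e} \<Longrightarrow> (F has_vector_derivative 1 / P s) (at s within {-e..1+e})"
    using antiderivative_continuous by blast
  have dF: "(F has_real_derivative 1 / P s) (at s)" if "-e < s" "s < 1 + e" for s
    using F[of s] that at_within_interior[of s "{-e..1+e}"]
    by (simp add: has_real_derivative_iff_has_vector_derivative)
  define J where "J = {-e<..<1+e}"
  have cF: "continuous_on J F"
    using DERIV_isCont[OF dF] unfolding J_def by (intro continuous_at_imp_continuous_on) simp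
  have mono: "F a < F b" if "a \<in> J" "b \<in> J" "a < b" for a b
  proof (rule DERIV_pos_imp_increasing[OF that(3)])
    fix x assume "a \<le> x" "x \<le> b"
    then have "-e < x" "x < 1 + e" using that by (auto simp: J_def)
    then show "\<exists>y. (F has_real_derivative y) (at x) \<and> 0 < y"
      using dF Ppos[of x] by (intro exI[of _ "1 / P x"]) auto
  qed
  have inj: "inj_on F J"
    using mono by (intro inj_onI) (metis linorder_neqE_linordered_idom less_irrefl)
  define G where "G = the_inv_into J F"
  have GF: "G (F x) = x" if "x \<in> J" for x
    unfolding G_def using the_inv_into_f_f[OF inj that] .
  have "connected (F ` J)" using connected_continuous_image[OF cF] by (simp add: J_def)
  then have int: "is_interval (F ` J)" by (simp add: is_interval_connected_1)
  have op: "open (F ` J)"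
    using invariance_of_domain[OF cF _ inj] by (simp add: J_def)
  have dG: "(G has_real_derivative P (G t)) (at t)" if t: "t \<in> F ` J" for t
  proof -
    obtain x where x: "x \<in> J" "t = F x" using t by blast
    have "(G has_derivative (\<lambda>h. h * P x)) (at (F x))"
    proof (rule has_derivative_inverse_strong[of J x F _ "\<lambda>h. h / P x"])
      show "(F has_derivative (\<lambda>h. h / P x)) (at x)"
      proof -
        have "(*) (1 / P x) = (\<lambda>h. h / P x)" by (simp add: fun_eq_iff)
        then show ?thesis using dF[of x] x by (simp add: J_def has_field_derivative_def)
      qed
      show "(\<lambda>h. h / P x) \<circ> (\<lambda>h. h * P x) = id" using Ppos[of x] x by (auto simp: J_def fun_eq_iff)
    qed (use x GF cF in \<open>auto simp: J_def\<close>)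
    then have "(G has_real_derivative P x) (at (F x))"
      by (simp add: has_field_derivative_def mult.commute[of _ "P x"])
    then show ?thesis using x GF by simp
  qed
  show ?thesis
  proof (rule that[of "F ` J" "F 0" "F 1" G])
    show "P (G t) > 0 \<and> (G has_real_derivative P (G t)) (at t)" if "t \<in> F ` J" for t
      using dG[OF that] that GF Ppos by (force simp: J_def)
    show "F 0 \<in> F ` J" "F 1 \<in> F ` J" using e by (auto simp: J_def)
    show "G (F 0) = 0" "G (F 1) = 1" using e GF by (auto simp: J_def)
  qed (use op int in auto)
qed

text \<open>Parametrise the segment by \<open>v + s (w - v)\<close> and let \<open>s\<close> solve the equation that makes
  the speed proportional to the squared height.\<close>

lemma segment_geodesic:
  fixes v w :: "real ^ 'n::finite"
  assumes hs: "half_space_coordinates p q X Y k" and seg: "closed_segment v w \<subseteq> straight_domain Y k"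
  obtains I \<gamma> \<gamma>' t0 t1 r where "geodesic (half_space k) (half_space_metric X Y k) I \<gamma> \<gamma>'"
    "t0 \<in> I" "t1 \<in> I" "\<gamma> t0 = unstraighten Y k v" "\<gamma> t1 = unstraighten Y k w"
    "((\<lambda>t. straighten Y k (\<gamma> t)) has_vector_derivative r *\<^sub>R (w - v)) (at t0)"
proof -
  define l where "l s = v + s *\<^sub>R (w - v)" for s :: real
  define P where "P s = l s $ k - horizontal_form Y k (l s) (l s)" for s
  have "continuous_on UNIV P" unfolding P_def l_def by (intro continuous_intros)
  moreover have "P s > 0" if "0 \<le> s" "s \<le> 1" for s
  proof -
    have "l s \<in> closed_segment v w"
      using that unfolding in_segment l_def by (intro exI[of _ s]) (simp add: algebra_simps)
    then show ?thesis using seg by (auto simp: straight_domain_def P_def)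
  qed
  ultimately obtain I s t0 t1 where s: "open I" "is_interval I" "t0 \<in> I" "t1 \<in> I" "s t0 = 0" "s t1 = 1"
    and ds: "\<And>t. t \<in> I \<Longrightarrow> P (s t) > 0 \<and> (s has_real_derivative P (s t)) (at t)"
    using autonomous_ode_solution_through_0_1[of P] by metis
  define c where "c t = l (s t)" for t
  have dc: "(c has_vector_derivative P (s t) *\<^sub>R (w - v)) (at t)" if "t \<in> I" for t
    unfolding c_def l_def using ds[OF that]
    by (auto intro!: derivative_eq_intros simp: has_real_derivative_iff_has_vector_derivative)
  have dom: "c t \<in> straight_domain Y k" if "t \<in> I" for t
    using ds[OF that] by (simp add: straight_domain_def P_def c_def)
  obtain \<gamma>' where geo: "geodesic (half_space k) (half_space_metric X Y k) I (\<lambda>t. unstraighten Y k (c t)) \<gamma>'"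
    using geodesic_unstraighten[OF hs s(1,2), of c "w - v"] dom dc unfolding P_def c_def by blast
  have "((\<lambda>t. straighten Y k (unstraighten Y k (c t))) has_vector_derivative P (s t0) *\<^sub>R (w - v)) (at t0)"
    by (rule has_vector_derivative_transform_within_open[OF dc[OF s(3)] s(1,3)])
       (simp add: straighten_unstraighten dom)
  then show ?thesis
    using that[OF geo s(3,4)] s(5,6) by (simp add: c_def l_def)
qed

section \<open>Flat sections\<close>

lemma straighten_has_derivative:
  "\<exists>f'. (straighten Y k has_derivative f') (at w)"
  using smooth_on_has_derivative[OF smooth_on_straighten[of UNIV Y k 0], of w] by auto

lemma unstraighten_has_derivative:
  "v \<in> straight_domain Y k \<Longrightarrow> \<exists>g'. (unstraighten Y k has_derivative g') (at v)"
  using smooth_on_has_derivative[OF smooth_on_unstraighten[of "straight_domain Y k" 0 Y k], of v]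
    open_straight_domain by auto

text \<open>The subset of the half-space that becomes a piece of \<open>E\<close> in straight coordinates.\<close>

definition flat_section :: "'n::finite set \<Rightarrow> 'n \<Rightarrow> (real ^ 'n) set \<Rightarrow> (real ^ 'n) set" where
  "flat_section Y k E = {w \<in> half_space k. straighten Y k w \<in> E}"

lemma flat_section_closedin:
  assumes "affine E"
  shows "closedin (top_of_set (half_space k)) (flat_section Y k E)"
proof -
  have "closedin (top_of_set (half_space k)) (half_space k \<inter> straighten Y k -` E)"
    using continuous_closedin_preimage[OF homeomorphism_cont1[OF homeomorphism_straighten]] closed_affine_hull[of E] assms
    by (metis affine_hull_eq)
  then show ?thesis by (simp add: flat_section_def vimage_def Int_def)
qed

text \<open>The straightening map, translated by \<open>- e\<close>, is one slice chart for the whole set.\<close>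

lemma submanifold_flat_section:
  assumes W: "subspace W" and ne: "flat_section Y k ((+) e ` W) \<noteq> {}"
  shows "submanifold (dim W) (flat_section Y k ((+) e ` W))"
  unfolding submanifold_def
proof (intro conjI ballI ne)
  fix m assume m: "m \<in> flat_section Y k ((+) e ` W)"
  let ?V = "(\<lambda>v. v - e) ` straight_domain Y k"
  have V: "open ?V" using open_translation_subtract[OF open_straight_domain] .
  have Vmem: "v \<in> ?V \<longleftrightarrow> v + e \<in> straight_domain Y k" for v by (force simp: image_iff)
  have hom: "homeomorphism (half_space k) ?V (\<lambda>w. straighten Y k w - e) (\<lambda>v. unstraighten Y k (v + e))"
  proof (rule homeomorphismI)
    show "continuous_on (half_space k) (\<lambda>w. straighten Y k w - e)"
      by (intro continuous_intros homeomorphism_cont1[OF homeomorphism_straighten])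
    show "continuous_on ?V (\<lambda>v. unstraighten Y k (v + e))"
      by (rule continuous_on_compose2[OF homeomorphism_cont2[OF homeomorphism_straighten[of k Y]]])
         (auto intro!: continuous_intros)
  qed (auto simp: Vmem straighten_in_domain unstraighten_in_half_space unstraighten_straighten straighten_unstraighten)
  have im: "(\<lambda>w. straighten Y k w - e) ` (half_space k \<inter> flat_section Y k ((+) e ` W)) = ?V \<inter> W"
  proof (intro equalityI subsetI)
    fix v assume "v \<in> ?V \<inter> W"
    then have v: "v + e \<in> straight_domain Y k" "v \<in> W" using Vmem by auto
    show "v \<in> (\<lambda>w. straighten Y k w - e) ` (half_space k \<inter> flat_section Y k ((+) e ` W))"
    proof (rule image_eqI[of _ _ "unstraighten Y k (v + e)"])
      show "unstraighten Y k (v + e) \<in> half_space k \<inter> flat_section Y k ((+) e ` W)"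
        using v by (auto simp: flat_section_def unstraighten_in_half_space straighten_unstraighten add.commute)
    qed (use v in \<open>simp add: straighten_unstraighten\<close>)
  next
    fix v assume "v \<in> (\<lambda>w. straighten Y k w - e) ` (half_space k \<inter> flat_section Y k ((+) e ` W))"
    then obtain w where w: "w \<in> half_space k" "straighten Y k w \<in> (+) e ` W" "v = straighten Y k w - e"
      by (auto simp: flat_section_def)
    then show "v \<in> ?V \<inter> W" using straighten_in_domain[OF w(1)] by auto
  qed
  have sm: "smooth_on (half_space k) (\<lambda>w. straighten Y k w - e)"
    "smooth_on ?V (\<lambda>v. unstraighten Y k (v + e))"
    using smooth_on_straighten[OF open_half_space] smooth_on_unstraighten[OF V] Vmem by blast+
  have mH: "m \<in> half_space k" using m by (simp add: flat_section_def)
  show "\<exists>U (V :: (real ^ 'a) set) \<phi> \<psi> S. open U \<and> m \<in> U \<and> open V \<and>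
        homeomorphism U V \<phi> \<psi> \<and> smooth_on U \<phi> \<and> smooth_on V \<psi> \<and>
        subspace S \<and> dim S = dim W \<and> \<phi> ` (U \<inter> flat_section Y k ((+) e ` W)) = V \<inter> S"
    by (rule exI[of _ "half_space k"], rule exI[of _ ?V], rule exI[of _ "\<lambda>w. straighten Y k w - e"],
        rule exI[of _ "\<lambda>v. unstraighten Y k (v + e)"], rule exI[of _ W])
       (intro conjI open_half_space mH V hom sm W refl im)
qed

text \<open>In straight coordinates a geodesic keeps its direction, so if it is tangent to an affine
  subspace at one point, its direction is parallel to that subspace for all time.\<close>

lemma totally_geodesic_flat_section:
  assumes hs: "half_space_coordinates p q X Y k"
    and W: "subspace W" and ne: "flat_section Y k ((+) e ` W) \<noteq> {}"
  shows "totally_geodesic (half_space k) (half_space_metric X Y k) (dim W) (flat_section Y k ((+) e ` W))"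
  unfolding totally_geodesic_def
proof (intro conjI submanifold_flat_section[OF W ne] allI impI)
  show "flat_section Y k ((+) e ` W) \<subseteq> half_space k" by (auto simp: flat_section_def)
  fix I \<gamma> \<gamma>'
  assume "geodesic (half_space k) (half_space_metric X Y k) I \<gamma> \<gamma>' \<and>
        (\<exists>t\<in>I. \<gamma> t \<in> flat_section Y k ((+) e ` W) \<and> \<gamma>' t \<in> tangent_space (flat_section Y k ((+) e ` W)) (\<gamma> t))"
  then obtain t0 where geo: "geodesic (half_space k) (half_space_metric X Y k) I \<gamma> \<gamma>'" and t0: "t0 \<in> I"
    and in0: "\<gamma> t0 \<in> flat_section Y k ((+) e ` W)"
    and tan: "\<gamma>' t0 \<in> tangent_space (flat_section Y k ((+) e ` W)) (\<gamma> t0)" by blast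
  have I: "is_interval I" and H: "\<And>t. t \<in> I \<Longrightarrow> \<gamma> t \<in> half_space k"
    and d0: "(\<gamma> has_vector_derivative \<gamma>' t0) (at t0)"
    using geo t0 unfolding geodesic_def by auto
  obtain A where A: "\<And>t. t \<in> I \<Longrightarrow> ((\<lambda>t. straighten Y k (\<gamma> t)) has_vector_derivative (\<gamma> t $ k)\<^sup>2 *\<^sub>R A) (at t)"
    using geodesic_straighten_velocity[OF hs geo] by blast
  obtain f' where f': "(straighten Y k has_derivative f') (at (\<gamma> t0))"
    using straighten_has_derivative by blast
  have "(straighten Y k \<circ> \<gamma> has_vector_derivative f' (\<gamma>' t0)) (at t0)"
    using vector_derivative_diff_chain_within[OF d0, of "straighten Y k" f'] f'
    by (simp add: has_derivative_at_withinI)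
  then have fA: "f' (\<gamma>' t0) = (\<gamma> t0 $ k)\<^sup>2 *\<^sub>R A"
    using vector_derivative_unique_at A[OF t0] by (fastforce simp: o_def)
  have "f' (\<gamma>' t0) \<in> W"
  proof -
    obtain c where c: "c 0 = \<gamma> t0" "\<forall>\<^sub>F t in nhds 0. c t \<in> flat_section Y k ((+) e ` W)"
      "(c has_vector_derivative \<gamma>' t0) (at 0)"
      using tan unfolding tangent_space_def by blast
    show ?thesis
    proof (rule has_vector_derivative_in_subspace[OF _ W])
      show "(straighten Y k \<circ> c has_vector_derivative f' (\<gamma>' t0)) (at 0)"
        using vector_derivative_diff_chain_within[OF c(3), of "straighten Y k" f'] f' c(1)
        by (simp add: has_derivative_at_withinI)
      show "\<forall>\<^sub>F t in nhds 0. (straighten Y k \<circ> c) t - (straighten Y k \<circ> c) 0 \<in> W"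
        using c(2)
      proof eventually_elim
        case (elim t)
        obtain a b where "a \<in> W" "straighten Y k (c t) = e + a" "b \<in> W" "straighten Y k (c 0) = e + b"
          using elim in0 c(1) unfolding flat_section_def by auto
        then show ?case using subspace_diff[OF W] by simp
      qed
    qed
  qed
  moreover have "\<gamma> t0 $ k > 0" using H[OF t0] by (simp add: half_space_def)
  ultimately have AW: "A \<in> W"
    using subspace_scale[OF W, of "(\<gamma> t0 $ k)\<^sup>2 *\<^sub>R A" "1 / (\<gamma> t0 $ k)\<^sup>2"] unfolding fA by simp
  show "\<gamma> ` I \<subseteq> flat_section Y k ((+) e ` W)"
  proof
    fix w assume "w \<in> \<gamma> ` I"
    then obtain t where t: "t \<in> I" "w = \<gamma> t" by blast
    have "straighten Y k (\<gamma> t) - straighten Y k (\<gamma> t0) \<in> W"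
      by (rule curve_diff_in_subspace[OF I W A]) (use t t0 AW subspace_scale[OF W] in auto)
    moreover obtain a where a: "a \<in> W" "straighten Y k (\<gamma> t0) = e + a"
      using in0 unfolding flat_section_def by auto
    ultimately have "a + (straighten Y k (\<gamma> t) - straighten Y k (\<gamma> t0)) \<in> W"
      using subspace_add[OF W] by blast
    moreover have "straighten Y k (\<gamma> t) = e + (a + (straighten Y k (\<gamma> t) - straighten Y k (\<gamma> t0)))"
      using a(2) by simp
    ultimately have "straighten Y k (\<gamma> t) \<in> (+) e ` W" by (rule rev_image_eqI)
    then show "w \<in> flat_section Y k ((+) e ` W)"
      using H[OF t(1)] t(2) unfolding flat_section_def by blast
  qed
qed

text \<open>The section is homeomorphic to an open subset of \<open>E\<close>, so it is locally connected.\<close>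

lemma openin_components_flat_section:
  assumes "affine E" "C \<in> components (flat_section Y k E)"
  shows "openin (top_of_set (flat_section Y k E)) C"
proof -
  have hom: "homeomorphism (flat_section Y k E) (straight_domain Y k \<inter> E) (straighten Y k) (unstraighten Y k)"
  proof (rule homeomorphism_of_subsets[OF homeomorphism_straighten])
    show "straighten Y k ` flat_section Y k E = straight_domain Y k \<inter> E"
    proof (intro equalityI subsetI)
      fix v assume "v \<in> straight_domain Y k \<inter> E"
      then show "v \<in> straighten Y k ` flat_section Y k E"
        by (intro image_eqI[of _ _ "unstraighten Y k v"])
           (auto simp: flat_section_def straighten_unstraighten unstraighten_in_half_space)
    qed (auto simp: flat_section_def straighten_in_domain)
  qed (auto simp: flat_section_def)
  have "locally connected (straight_domain Y k \<inter> E)"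
  proof (rule locally_open_subset)
    show "locally connected E"
      by (rule convex_imp_locally_connected[OF affine_imp_convex[OF assms(1)]])
    show "openin (top_of_set E) (straight_domain Y k \<inter> E)"
      using open_straight_domain by (metis openin_open inf_commute)
  qed
  moreover have "locally connected (flat_section Y k E) \<longleftrightarrow> locally connected (straight_domain Y k \<inter> E)"
  proof (rule homeomorphic_locally)
    show "flat_section Y k E homeomorphic straight_domain Y k \<inter> E"
      unfolding homeomorphic_def using hom by (intro exI)
  qed (rule homeomorphic_connectedness)
  ultimately show ?thesis by (intro openin_components_locally_connected[OF _ assms(2)]) simp
qed

lemma maximal_component_flat_section:
  assumes hs: "half_space_coordinates p q X Y k"
    and W: "subspace W" and C: "C \<in> components (flat_section Y k ((+) e ` W))"
  shows "maximal_totally_geodesic (half_space k) (half_space_metric X Y k) C"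
    and "totally_geodesic (half_space k) (half_space_metric X Y k) (dim W) C"
proof -
  have aff: "affine ((+) e ` W)" using W affine_translation subspace_imp_affine by blast
  have ne: "flat_section Y k ((+) e ` W) \<noteq> {}"
    using in_components_nonempty[OF C] in_components_subset[OF C] by blast
  show tg: "totally_geodesic (half_space k) (half_space_metric X Y k) (dim W) C"
    using totally_geodesic_component[OF totally_geodesic_flat_section[OF hs W ne] C]
      openin_components_flat_section[OF aff C] by blast
  have "closedin (top_of_set (half_space k)) C"
    using closedin_trans[OF closedin_component[OF C] flat_section_closedin[OF aff]] .
  then show "maximal_totally_geodesic (half_space k) (half_space_metric X Y k) C"
    using maximal_totally_geodesic_if_closed[OF tg in_components_connected[OF C]] by blast
qed

section \<open>Local and global form of totally geodesic submanifolds\<close>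

text \<open>Near the point \<open>v\<close> of \<open>E1\<close> corresponding to \<open>m\<close> all of \<open>E1\<close> is visible in the
  half-space; a point \<open>e\<close> of \<open>E1\<close> lies on a line through \<open>v\<close> and a second point so close to
  \<open>v\<close> that it lies in \<open>E2\<close> too.\<close>

lemma flat_section_germ_subset:
  assumes "affine E2" and m: "m \<in> flat_section Y k E1" "m \<in> flat_section Y k E2"
    and "affine E1" and O': "open O'" "m \<in> O'" "flat_section Y k E1 \<inter> O' \<subseteq> flat_section Y k E2"
  shows "E1 \<subseteq> E2"
proof
  fix e assume e: "e \<in> E1"
  define v where "v = straighten Y k m"
  have v: "v \<in> E1" "v \<in> E2" "v \<in> straight_domain Y k" "unstraighten Y k v = m"
    using m by (auto simp: flat_section_def v_def straighten_in_domain unstraighten_straighten)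
  have "open (straight_domain Y k \<inter> unstraighten Y k -` O')"
    using continuous_open_preimage[OF homeomorphism_cont2[OF homeomorphism_straighten] open_straight_domain O'(1)] .
  then obtain r where r: "r > 0" "ball v r \<subseteq> straight_domain Y k \<inter> unstraighten Y k -` O'"
    by (rule openE[of _ v]) (use v O'(2) in auto)
  \<comment> \<open>scales \<open>e - v\<close> to a length less than \<open>r\<close>, also if \<open>e = v\<close>\<close>
  define t where "t = r / (2 * (norm (e - v) + 1))"
  have t: "t > 0" using r by (simp add: t_def add_nonneg_pos)
  have "t * norm (e - v) < r"
  proof -
    have "norm (e - v) / (2 * (norm (e - v) + 1)) < 1"
      by (simp add: divide_less_eq add_nonneg_pos)
    then show ?thesis
      using mult_strict_left_mono[OF _ r(1), of "norm (e - v) / (2 * (norm (e - v) + 1))" 1]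
      by (simp add: t_def)
  qed
  then have "v + t *\<^sub>R (e - v) \<in> ball v r" using t by (simp add: dist_norm)
  then have b: "v + t *\<^sub>R (e - v) \<in> straight_domain Y k" "unstraighten Y k (v + t *\<^sub>R (e - v)) \<in> O'"
    using r(2) by auto
  have "v + t *\<^sub>R (e - v) \<in> E1"
    using mem_affine_3_minus[OF assms(4) v(1) e v(1), of t] .
  then have "unstraighten Y k (v + t *\<^sub>R (e - v)) \<in> flat_section Y k E1 \<inter> O'"
    using b by (simp add: flat_section_def unstraighten_in_half_space straighten_unstraighten)
  then have "v + t *\<^sub>R (e - v) \<in> E2"
    using O'(3) b by (auto simp: flat_section_def straighten_unstraighten)
  from mem_affine_3_minus[OF assms(1) v(2) this v(2), of "1 / t"] show "e \<in> E2"
    using t by simp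
qed

text \<open>Let \<open>E\<close> be the affine subspace tangent to \<open>M\<close> at \<open>m\<close> in straight coordinates.  Every
  point of \<open>E\<close> near \<open>m\<close> is joined to \<open>m\<close> by a segment; the corresponding geodesic is tangent
  to \<open>M\<close> at \<open>m\<close> and hence stays in \<open>M\<close>.  So near \<open>m\<close> the section of \<open>E\<close> is contained in
  \<open>M\<close>, and as both have the same dimension, invariance of domain makes them agree near \<open>m\<close>.\<close>

lemma totally_geodesic_locally_flat:
  assumes hs: "half_space_coordinates p q X Y k"
    and tg: "totally_geodesic (half_space k) (half_space_metric X Y k) d M" and m: "m \<in> M"
  shows "\<exists>W O'. subspace W \<and> dim W = d \<and> open O' \<and> m \<in> O' \<and>
    M \<inter> O' = flat_section Y k ((+) (straighten Y k m) ` W) \<inter> O'"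
proof -
  have MH: "M \<subseteq> half_space k" and sub: "submanifold d M" using tg unfolding totally_geodesic_def by auto
  have mH: "m \<in> half_space k" using m MH by blast
  define v where "v = straighten Y k m"
  have vD: "v \<in> straight_domain Y k" using mH by (simp add: v_def straighten_in_domain)
  obtain f' where f': "(straighten Y k has_derivative f') (at m)" using straighten_has_derivative by blast
  obtain g' where g': "(unstraighten Y k has_derivative g') (at (straighten Y k m))"
    using unstraighten_has_derivative vD v_def by blast
  \<comment> \<open>the direction of the affine subspace tangent to \<open>M\<close> in straight coordinates\<close>
  define W where "W = f' ` tangent_space M m"
  have Weq: "tangent_space (straighten Y k ` M) v = W" and inj: "inj f'"
    using tangent_space_diffeo[OF open_half_space open_straight_domain homeomorphism_straighten MH m f' g']
    unfolding W_def v_def by auto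
  have lin: "linear f'" using f' has_derivative_linear by blast
  have W: "subspace W" "dim W = d"
  proof -
    show "subspace W" unfolding W_def
      using linear_subspace_image[OF lin tangent_space_submanifold(1)[OF sub m]] .
    show "dim W = d" unfolding W_def
      using dim_image_eq[OF lin, of "tangent_space M m"] tangent_space_submanifold(2)[OF sub m]
        inj_on_subset[OF inj] by simp
  qed
  let ?F = "flat_section Y k ((+) v ` W)"
  obtain r where r: "r > 0" "ball v r \<subseteq> straight_domain Y k"
    using openE[OF open_straight_domain vD] by blast
  define U where "U = half_space k \<inter> straighten Y k -` ball v r"
  have U: "open U" unfolding U_def
    using continuous_open_preimage[OF homeomorphism_cont1[OF homeomorphism_straighten] open_half_space open_ball] .
  have mU: "m \<in> U" using mH r by (simp add: U_def v_def)
  have mF: "m \<in> ?F"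
    using mH image_eqI[OF _ subspace_0[OF W(1)], of v "(+) v"] by (simp add: flat_section_def v_def)
  have FU: "?F \<inter> U \<subseteq> M"
  proof
    fix n assume n: "n \<in> ?F \<inter> U"
    define w where "w = straighten Y k n"
    have nH: "n \<in> half_space k" and w: "w - v \<in> W" "w \<in> ball v r"
      using n by (auto simp: flat_section_def w_def U_def)
    have "closed_segment v w \<subseteq> ball v r"
      using closed_segment_subset[OF _ w(2) convex_ball] r(1) by simp
    then have seg: "closed_segment v w \<subseteq> straight_domain Y k" using r(2) by blast
    obtain I \<gamma> \<gamma>' t0 t1 r' where geo: "geodesic (half_space k) (half_space_metric X Y k) I \<gamma> \<gamma>'"
      and t: "t0 \<in> I" "t1 \<in> I" and ends: "\<gamma> t0 = unstraighten Y k v" "\<gamma> t1 = unstraighten Y k w"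
      and d: "((\<lambda>t. straighten Y k (\<gamma> t)) has_vector_derivative r' *\<^sub>R (w - v)) (at t0)"
      by (rule segment_geodesic[OF hs seg])
    have e: "\<gamma> t0 = m" "\<gamma> t1 = n"
      using ends mH nH by (simp_all add: v_def w_def unstraighten_straighten)
    have d0: "(\<gamma> has_vector_derivative \<gamma>' t0) (at t0)" using geo t unfolding geodesic_def by blast
    have "(straighten Y k \<circ> \<gamma> has_vector_derivative f' (\<gamma>' t0)) (at t0)"
      using vector_derivative_diff_chain_within[OF d0, of "straighten Y k" f'] f' e
      by (simp add: has_derivative_at_withinI)
    then have "f' (\<gamma>' t0) = r' *\<^sub>R (w - v)"
      using vector_derivative_unique_at d by (fastforce simp: o_def)
    then have "f' (\<gamma>' t0) \<in> W" using subspace_scale[OF W(1) w(1)] by simp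
    then have "\<gamma>' t0 \<in> tangent_space M (\<gamma> t0)"
      unfolding W_def e inj_image_mem_iff[OF inj] .
    then have "\<gamma> ` I \<subseteq> M" using tg geo t(1) m e unfolding totally_geodesic_def by blast
    then show "n \<in> M" using t(2) e(2) by blast
  qed
  have "?F \<noteq> {}" using mF by blast
  then have "submanifold d ?F" using submanifold_flat_section[OF W(1), of Y k v] W(2) by simp
  then have "submanifold d (?F \<inter> U)"
  proof (rule submanifold_openin_subset)
    show "openin (top_of_set ?F) (?F \<inter> U)" using U by (rule openin_open_Int)
    show "?F \<inter> U \<noteq> {}" using mF mU by blast
  qed
  then have "openin (top_of_set M) (?F \<inter> U)"
    using submanifold_openin_of_subset[OF sub _ FU] by blast
  then obtain O' where O': "open O'" "?F \<inter> U = M \<inter> O'" by (auto simp: openin_open)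
  have "m \<in> O' \<inter> U" using O'(2) mF mU by blast
  moreover have "M \<inter> (O' \<inter> U) = ?F \<inter> (O' \<inter> U)" using O'(2) by blast
  ultimately show ?thesis
    using W open_Int[OF O'(1) U] unfolding v_def
    by (intro exI[of _ W] exI[of _ "O' \<inter> U"] conjI)
qed

text \<open>The affine subspace that describes \<open>M\<close> near a point is determined by the germ of \<open>M\<close>
  there, so it is locally constant along \<open>M\<close>, and \<open>M\<close> is connected.\<close>

lemma connected_totally_geodesic_subset_flat_section:
  assumes hs: "half_space_coordinates p q X Y k"
    and tg: "totally_geodesic (half_space k) (half_space_metric X Y k) d M" and con: "connected M"
  shows "\<exists>e W. subspace W \<and> dim W = d \<and> M \<subseteq> flat_section Y k ((+) e ` W)"
proof -
  have "\<forall>m\<in>M. \<exists>W O'. subspace W \<and> dim W = d \<and> open O' \<and> m \<in> O' \<and>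
    M \<inter> O' = flat_section Y k ((+) (straighten Y k m) ` W) \<inter> O'"
    using totally_geodesic_locally_flat[OF hs tg] by blast
  then obtain W O' where WO: "\<forall>m\<in>M. subspace (W m) \<and> dim (W m) = d \<and> open (O' m) \<and> m \<in> O' m \<and>
    M \<inter> O' m = flat_section Y k ((+) (straighten Y k m) ` W m) \<inter> O' m"
    unfolding bchoice_iff by (elim exE)
  then have W: "\<And>m. m \<in> M \<Longrightarrow> subspace (W m) \<and> dim (W m) = d"
    and O': "\<And>m. m \<in> M \<Longrightarrow> open (O' m) \<and> m \<in> O' m"
    and eq: "\<And>m. m \<in> M \<Longrightarrow> M \<inter> O' m = flat_section Y k ((+) (straighten Y k m) ` W m) \<inter> O' m"
    by simp_all
  define E where "E m = (+) (straighten Y k m) ` W m" for m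
  have aff: "affine (E m)" if "m \<in> M" for m
    unfolding E_def using W[OF that] affine_translation subspace_imp_affine by blast
  have mE: "m \<in> flat_section Y k (E m)" if "m \<in> M" for m
    using eq[OF that] O'[OF that] that unfolding E_def by blast
  have loc: "E m = E n" if m: "m \<in> M" and n: "n \<in> M" "n \<in> O' m" for m n
  proof -
    have "flat_section Y k (E m) \<inter> (O' m \<inter> O' n) = flat_section Y k (E n) \<inter> (O' m \<inter> O' n)"
      using eq[OF m] eq[OF n(1)] unfolding E_def by blast
    moreover have "n \<in> flat_section Y k (E m)" using eq[OF m] n unfolding E_def by blast
    moreover have "open (O' m \<inter> O' n)" "n \<in> O' m \<inter> O' n" using O' m n by auto
    ultimately show ?thesis
      using flat_section_germ_subset[of "E n" n Y k "E m" "O' m \<inter> O' n"]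
        flat_section_germ_subset[of "E m" n Y k "E n" "O' m \<inter> O' n"] aff[OF m] aff[OF n(1)] mE[OF n(1)]
      by blast
  qed
  have "M \<noteq> {}" using tg unfolding totally_geodesic_def submanifold_def by blast
  then obtain m where m: "m \<in> M" by blast
  have "E n = E m" if n: "n \<in> M" for n
  proof (rule connected_local_const[OF con n m], rule ballI)
    fix a assume a: "a \<in> M"
    show "\<forall>\<^sub>F b in at a within M. E a = E b"
      unfolding eventually_at_topological using O'[OF a] loc[OF a] by blast
  qed
  then have "M \<subseteq> flat_section Y k (E m)" using mE by auto
  then show ?thesis using W[OF m] unfolding E_def by blast
qed

lemma affine_eq_translated_subspace:
  assumes "affine E" "E \<noteq> {}"
  obtains e W where "subspace W" "E = (+) e ` W"
proof -
  obtain W where "subspace W" "affine_parallel E W"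
    using affine_parallel_subspace[OF assms] by (elim ex1E conjE)
  then show ?thesis
    using that affine_parallel_commute[of E W] unfolding affine_parallel_def by blast
qed

text \<open>The classification in straight coordinates.  Components of sections are maximal because they
  are closed in the half-space; conversely a maximal \<open>M\<close> lies in some section of its own dimension,
  hence in one of its components, and cannot be smaller than that component.\<close>

theorem maximal_totally_geodesic_iff_flat_component:
  assumes hs: "half_space_coordinates p q X Y k"
  shows "maximal_totally_geodesic (half_space k) (half_space_metric X Y k) M \<longleftrightarrow>
    (\<exists>E. affine E \<and> M \<in> components (flat_section Y k E))"
proof
  assume "\<exists>E. affine E \<and> M \<in> components (flat_section Y k E)"
  then obtain E where E: "affine E" "M \<in> components (flat_section Y k E)" by blast
  then have "E \<noteq> {}" by (auto simp: flat_section_def)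
  then obtain e W where W: "subspace W" "E = (+) e ` W"
    by (rule affine_eq_translated_subspace[OF E(1)])
  show "maximal_totally_geodesic (half_space k) (half_space_metric X Y k) M"
    using maximal_component_flat_section(1)[OF hs W(1) E(2)[unfolded W(2)]] .
next
  assume "maximal_totally_geodesic (half_space k) (half_space_metric X Y k) M"
  then obtain d where tg: "totally_geodesic (half_space k) (half_space_metric X Y k) d M"
    and con: "connected M"
    and max: "\<not> (\<exists>N. totally_geodesic (half_space k) (half_space_metric X Y k) d N \<and> connected N \<and> M \<subset> N)"
    unfolding maximal_totally_geodesic_def by (elim exE conjE)
  obtain e W where W: "subspace W" "dim W = d" "M \<subseteq> flat_section Y k ((+) e ` W)"
    using connected_totally_geodesic_subset_flat_section[OF hs tg con] by (elim exE conjE)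
  have aff: "affine ((+) e ` W)"
    using affine_translation[of W e] subspace_imp_affine[OF W(1)] by (rule iffD1)
  have "M \<noteq> {}" using tg unfolding totally_geodesic_def submanifold_def by simp
  then have ne: "flat_section Y k ((+) e ` W) \<noteq> {}" using W(3) by auto
  obtain C where C: "C \<in> components (flat_section Y k ((+) e ` W))" "M \<subseteq> C"
    using exists_component_superset[OF W(3) ne con] by (elim exE conjE)
  have "totally_geodesic (half_space k) (half_space_metric X Y k) d C"
    using maximal_component_flat_section(2)[OF hs W(1) C(1)] W(2) by simp
  then have "M = C"
    using max in_components_connected[OF C(1)] C(2) by blast
  then show "\<exists>E. affine E \<and> M \<in> components (flat_section Y k E)" using C(1) aff by (intro exI conjI) simp_all
qed

section \<open>Vertical subspaces and quadrics as flat sections\<close>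

lemma affine_linear_vimage:
  assumes "linear f" "affine L"
  shows "affine (f -` L)"
  using assms(2) unfolding affine_def by (simp add: linear_add[OF assms(1)] linear_scale[OF assms(1)])

lemma affine_boundary_affine_subspace: "boundary_affine_subspace k L \<Longrightarrow> affine L"
  by (simp add: boundary_affine_subspace_def)

lemma boundary_projection_eq: "boundary_projection k w = w - w $ k *\<^sub>R axis k 1"
  by (simp add: vec_eq_iff boundary_projection_def axis_def)

lemma linear_boundary_projection: "linear (boundary_projection k)"
  by (rule linearI) (simp_all add: boundary_projection_eq algebra_simps)

lemma boundary_projection_straighten: "boundary_projection k (straighten Y k w) = boundary_projection k w"
  by (simp add: vec_eq_iff boundary_projection_def straighten_nth)

lemma boundary_projection_in_boundary: "boundary_projection k w \<in> half_space_boundary k"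
  by (simp add: boundary_projection_def half_space_boundary_def)

lemma vertical_subspace_eq_flat_section:
  "vertical_subspace k L = flat_section Y k (boundary_projection k -` L)"
  by (simp add: vertical_subspace_def flat_section_def boundary_projection_straighten)

lemma convex_vertical_subspace:
  assumes "affine L"
  shows "convex (vertical_subspace k L)"
proof -
  have "vertical_subspace k L = {w. axis k 1 \<bullet> w > 0} \<inter> boundary_projection k -` L"
    by (auto simp: vertical_subspace_def half_space_def inner_axis')
  then show ?thesis
    using convex_Int[OF convex_halfspace_gt affine_imp_convex[OF affine_linear_vimage[OF linear_boundary_projection assms]]]
    by metis
qed

lemma vertical_subspace_nonempty:
  assumes "boundary_affine_subspace k L"
  shows "vertical_subspace k L \<noteq> {}"
proof -
  obtain l where l: "l \<in> L" "l $ k = 0"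
    using assms by (auto simp: boundary_affine_subspace_def half_space_boundary_def)
  then have "l + axis k 1 \<in> vertical_subspace k L"
    by (simp add: vertical_subspace_def half_space_def boundary_projection_eq)
  then show ?thesis by blast
qed

lemma components_vertical_subspace:
  assumes "boundary_affine_subspace k L"
  shows "components (vertical_subspace k L) = {vertical_subspace k L}"
  using convex_connected[OF convex_vertical_subspace[OF affine_boundary_affine_subspace[OF assms]]]
    vertical_subspace_nonempty[OF assms]
  by (simp add: components_eq_sing_iff)

text \<open>Expanding the square, \<open>\<langle>u - b, u - b\<rangle> + z\<^sup>2 = (\<langle>u, u\<rangle> + z\<^sup>2) - 2 \<langle>b, u\<rangle> + \<langle>b, b\<rangle>\<close>: the
  quadratic part is the last straight coordinate, so the equation becomes affine.\<close>

lemma half_space_quadric_eq: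
  assumes hs: "half_space_coordinates p q X Y k"
  shows "half_space_quadric X Y k b c =
    flat_section Y k {v. v $ k - 2 * horizontal_form Y k b v = c - horizontal_form Y k b b}"
proof -
  have XY: "X \<union> Y = -{k}" "X \<inter> Y = {}" using hs by (auto simp: half_space_coordinates_def)
  have sq: "(\<Sum>i\<in>X. (w $ i - b $ i)\<^sup>2) - (\<Sum>i\<in>Y. (w $ i - b $ i)\<^sup>2)
      = horizontal_form Y k w w - 2 * horizontal_form Y k b w + horizontal_form Y k b b" for w
  proof -
    have "(\<Sum>i\<in>X. (w $ i - b $ i)\<^sup>2) - (\<Sum>i\<in>Y. (w $ i - b $ i)\<^sup>2)
        = (\<Sum>i\<in>X. signature_sign Y i * (w $ i - b $ i)\<^sup>2) + (\<Sum>i\<in>Y. signature_sign Y i * (w $ i - b $ i)\<^sup>2)"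
    proof -
      have "(\<Sum>i\<in>X. signature_sign Y i * (w $ i - b $ i)\<^sup>2) = (\<Sum>i\<in>X. (w $ i - b $ i)\<^sup>2)"
        using XY(2) by (intro sum.cong) (auto simp: signature_sign_def)
      moreover have "(\<Sum>i\<in>Y. signature_sign Y i * (w $ i - b $ i)\<^sup>2) = - (\<Sum>i\<in>Y. (w $ i - b $ i)\<^sup>2)"
        by (simp add: signature_sign_def sum_negf)
      ultimately show ?thesis by simp
    qed
    also have "\<dots> = (\<Sum>i\<in>-{k}. signature_sign Y i * (w $ i - b $ i)\<^sup>2)"
      using sum.union_disjoint[of X Y "\<lambda>i. signature_sign Y i * (w $ i - b $ i)\<^sup>2"] XY by simp
    also have "\<dots> = horizontal_form Y k w w - 2 * horizontal_form Y k b w + horizontal_form Y k b b"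
      unfolding horizontal_form_def sum_distrib_left sum_subtractf[symmetric] sum.distrib[symmetric]
      by (intro sum.cong refl) (simp add: power2_eq_square algebra_simps)
    finally show ?thesis .
  qed
  have h: "horizontal_form Y k b (straighten Y k w) = horizontal_form Y k b w" for w
    by (rule horizontal_form_cong) (simp_all add: straighten_nth)
  show ?thesis
    unfolding half_space_quadric_def flat_section_def sq
    by (auto simp: h straighten_nth)
qed

lemma quadric_section_eq_flat_section:
  assumes "half_space_coordinates p q X Y k"
  shows "half_space_quadric X Y k b c \<inter> vertical_subspace k L = flat_section Y k
    ({v. v $ k - 2 * horizontal_form Y k b v = c - horizontal_form Y k b b} \<inter> boundary_projection k -` L)"
  unfolding half_space_quadric_eq[OF assms] vertical_subspace_eq_flat_section[of k L Y]
  by (auto simp: flat_section_def)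

lemma affine_quadric_section:
  assumes "boundary_affine_subspace k L"
  shows "affine ({v. v $ k - 2 * horizontal_form Y k b v = a} \<inter> boundary_projection k -` L)"
proof (rule affine_Int)
  have "linear (\<lambda>v. v $ k - 2 * horizontal_form Y k b v)"
    by (rule linearI) (simp_all add: horizontal_form_simps algebra_simps)
  from affine_linear_vimage[OF this affine_sing[of a]]
  show "affine {v. v $ k - 2 * horizontal_form Y k b v = a}" by (simp add: vimage_def)
  show "affine (boundary_projection k -` L)"
    by (rule affine_linear_vimage[OF linear_boundary_projection affine_boundary_affine_subspace[OF assms]])
qed

text \<open>If the direction of \<open>E\<close> contains the vertical axis, the section is a vertical subspace.
  Otherwise \<open>E\<close> is a graph over its projection \<open>L\<close>: it is cut out of the preimage of \<open>L\<close> by one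
  equation \<open>u \<bullet> v = const\<close> with \<open>u $ k = 1\<close>, and since the horizontal form is nondegenerate, its
  horizontal part can be written as \<open>- 2 \<langle>b, v\<rangle>\<close> for a centre \<open>b\<close>.\<close>

lemma flat_section_cases:
  fixes k :: "'n::finite"
  assumes hs: "half_space_coordinates p q X Y k" and E: "affine E" "E \<noteq> {}"
  shows "(\<exists>L. boundary_affine_subspace k L \<and> flat_section Y k E = vertical_subspace k L) \<or>
    (\<exists>L b c. boundary_affine_subspace k L \<and> b \<in> half_space_boundary k \<and>
      flat_section Y k E = half_space_quadric X Y k b c \<inter> vertical_subspace k L)"
proof -
  obtain e W where W: "subspace W" and EW: "E = (+) e ` W"
    by (rule affine_eq_translated_subspace[OF E])
  have memE: "v \<in> E \<longleftrightarrow> v - e \<in> W" for v unfolding EW by (force simp: image_iff)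
  show ?thesis
  proof (cases "axis k 1 \<in> W")
    case True
    define L where "L = E \<inter> half_space_boundary k"
    have bpE: "boundary_projection k v \<in> E \<longleftrightarrow> v \<in> E" for v
    proof -
      have "v - e = (boundary_projection k v - e) + v $ k *\<^sub>R axis k 1"
        by (simp add: boundary_projection_eq)
      then show ?thesis
        unfolding memE using subspace_add[OF W] subspace_diff[OF W] subspace_scale[OF W True]
        by (metis add_diff_cancel)
    qed
    have "affine (half_space_boundary k)"
      unfolding half_space_boundary_def affine_def by simp
    moreover have "boundary_projection k e \<in> L"
      using bpE[of e] subspace_0[OF W] by (simp add: L_def boundary_projection_in_boundary memE)
    ultimately have "boundary_affine_subspace k L"
      unfolding boundary_affine_subspace_def using affine_Int[OF E(1)] by (auto simp: L_def)
    moreover have "flat_section Y k E = vertical_subspace k L"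
      unfolding vertical_subspace_eq_flat_section[of k L Y]
      by (auto simp: flat_section_def L_def bpE boundary_projection_in_boundary)
    ultimately show ?thesis by blast
  next
    case False
    obtain y z where yz: "y \<in> W" "\<And>w. w \<in> W \<Longrightarrow> orthogonal z w" "axis k 1 = y + z"
      using orthogonal_subspace_decomp_exists[of W "axis k (1::real)"] span_eq_iff[of W] W by metis
    have zz: "z \<bullet> z \<noteq> 0" using yz False by auto
    define u where "u = (1 / (z \<bullet> z)) *\<^sub>R z"
    have uW: "u \<bullet> w = 0" if "w \<in> W" for w using yz(2)[OF that] by (simp add: u_def orthogonal_def)
    have "u \<bullet> axis k 1 = 1"
      unfolding yz(3) inner_add_right uW[OF yz(1)] using zz by (simp add: u_def)
    then have uk: "u $ k = 1" by (simp add: inner_axis)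
    define L where "L = boundary_projection k ` E"
    \<comment> \<open>chosen so that \<open>- 2 \<langle>b, v\<rangle>\<close> is the horizontal part of \<open>u \<bullet> v\<close>\<close>
    define b where "b = (\<chi> i. if i = k then 0 else - signature_sign Y i * u $ i / 2)"
    define c where "c = u \<bullet> e + horizontal_form Y k b b"
    have "L = (+) (boundary_projection k e) ` boundary_projection k ` W"
      unfolding L_def EW image_image by (simp add: linear_add[OF linear_boundary_projection])
    then have "affine L"
      using affine_translation subspace_imp_affine[OF linear_subspace_image[OF linear_boundary_projection W]] by metis
    then have L: "boundary_affine_subspace k L"
      using E(2) by (auto simp: boundary_affine_subspace_def L_def boundary_projection_in_boundary)
    have b: "b \<in> half_space_boundary k" by (simp add: b_def half_space_boundary_def)
    have ub: "v $ k - 2 * horizontal_form Y k b v = u \<bullet> v" for v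
    proof -
      have "u \<bullet> v = u $ k * v $ k + (\<Sum>i\<in>-{k}. u $ i * v $ i)"
        unfolding inner_vec_def by (subst sum.remove[of UNIV k]) (simp_all add: Compl_eq_Diff_UNIV)
      moreover have "horizontal_form Y k b v = (\<Sum>i\<in>-{k}. (- 1 / 2) * (u $ i * v $ i))"
        unfolding horizontal_form_def
        by (intro sum.cong refl) (auto simp: b_def signature_sign_def)
      ultimately show ?thesis unfolding sum_distrib_left[symmetric] by (simp add: uk)
    qed
    have "E = {v. u \<bullet> v = u \<bullet> e} \<inter> boundary_projection k -` L"
    proof (intro equalityI subsetI)
      fix v assume "v \<in> E"
      then show "v \<in> {v. u \<bullet> v = u \<bullet> e} \<inter> boundary_projection k -` L"
        using uW[of "v - e"] by (auto simp: memE L_def inner_diff_right)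
    next
      fix v assume v: "v \<in> {v. u \<bullet> v = u \<bullet> e} \<inter> boundary_projection k -` L"
      then obtain e' where e': "e' \<in> E" "boundary_projection k v = boundary_projection k e'"
        unfolding L_def by auto
      have d: "v - e' = (v $ k - e' $ k) *\<^sub>R axis k 1"
        using e'(2) by (simp add: boundary_projection_eq algebra_simps)
      have "u \<bullet> (v - e') = 0"
        using v uW[of "e' - e"] e'(1) by (simp add: memE inner_diff_right)
      then have "v $ k - e' $ k = 0" unfolding d by (simp add: inner_axis uk)
      then have "v = e'" using d by simp
      then show "v \<in> E" using e'(1) by simp
    qed
    then have "flat_section Y k E = half_space_quadric X Y k b c \<inter> vertical_subspace k L"
      unfolding quadric_section_eq_flat_section[OF hs] ub by (simp add: c_def)
    with L b show ?thesis by blast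
  qed
qed

theorem theorem3p4:
  fixes p q :: nat and X Y :: "'n::finite set" and k :: 'n
  assumes "p \<ge> 1" and "q \<ge> 0" and "half_space_coordinates p q X Y k"
  shows "(\<forall>M. maximal_totally_geodesic (half_space k) (half_space_metric X Y k) M \<longleftrightarrow>
            (\<exists>L. boundary_affine_subspace k L \<and> M = vertical_subspace k L) \<or>
            (\<exists>L b c. boundary_affine_subspace k L \<and> b \<in> half_space_boundary k \<and>
               M \<in> components (half_space_quadric X Y k b c \<inter> vertical_subspace k L)))
       \<and> (\<forall>L b c. boundary_affine_subspace k L \<and> b \<in> half_space_boundary k \<and>
            half_space_quadric X Y k b c \<inter> vertical_subspace k L \<noteq> {} \<longrightarrow>
            (\<exists>d. totally_geodesic (half_space k) (half_space_metric X Y k) d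
                  (half_space_quadric X Y k b c \<inter> vertical_subspace k L)))"
proof (intro conjI allI impI)
  note hs = assms(3)
  fix M
  show "maximal_totally_geodesic (half_space k) (half_space_metric X Y k) M \<longleftrightarrow>
            (\<exists>L. boundary_affine_subspace k L \<and> M = vertical_subspace k L) \<or>
            (\<exists>L b c. boundary_affine_subspace k L \<and> b \<in> half_space_boundary k \<and>
               M \<in> components (half_space_quadric X Y k b c \<inter> vertical_subspace k L))"
    unfolding maximal_totally_geodesic_iff_flat_component[OF hs]
  proof
    assume "\<exists>E. affine E \<and> M \<in> components (flat_section Y k E)"
    then obtain E where E: "affine E" "M \<in> components (flat_section Y k E)" by blast
    then have "E \<noteq> {}" by (auto simp: flat_section_def)
    from flat_section_cases[OF hs E(1) this]
    show "(\<exists>L. boundary_affine_subspace k L \<and> M = vertical_subspace k L) \<or>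
            (\<exists>L b c. boundary_affine_subspace k L \<and> b \<in> half_space_boundary k \<and>
               M \<in> components (half_space_quadric X Y k b c \<inter> vertical_subspace k L))"
    proof (elim disjE exE conjE)
      fix L assume L: "boundary_affine_subspace k L" "flat_section Y k E = vertical_subspace k L"
      have "M = vertical_subspace k L"
        using E(2) unfolding L(2) components_vertical_subspace[OF L(1)] by (rule singletonD)
      then show ?thesis using L(1) by (intro disjI1 exI conjI)
    next
      fix L b c assume L: "boundary_affine_subspace k L" "b \<in> half_space_boundary k"
        "flat_section Y k E = half_space_quadric X Y k b c \<inter> vertical_subspace k L"
      have "M \<in> components (half_space_quadric X Y k b c \<inter> vertical_subspace k L)"
        using E(2) unfolding L(3) .
      then show ?thesis using L(1,2) by (intro disjI2 exI conjI)
    qed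
  next
    assume "(\<exists>L. boundary_affine_subspace k L \<and> M = vertical_subspace k L) \<or>
            (\<exists>L b c. boundary_affine_subspace k L \<and> b \<in> half_space_boundary k \<and>
               M \<in> components (half_space_quadric X Y k b c \<inter> vertical_subspace k L))"
    then show "\<exists>E. affine E \<and> M \<in> components (flat_section Y k E)"
    proof (elim disjE exE conjE)
      fix L assume L: "boundary_affine_subspace k L" "M = vertical_subspace k L"
      have "M \<in> components (flat_section Y k (boundary_projection k -` L))"
        unfolding vertical_subspace_eq_flat_section[of k L Y, symmetric] components_vertical_subspace[OF L(1)]
        using L(2) by (rule ssubst) (rule singletonI)
      moreover have "affine (boundary_projection k -` L)"
        by (rule affine_linear_vimage[OF linear_boundary_projection affine_boundary_affine_subspace[OF L(1)]])
      ultimately show ?thesis by (intro exI conjI)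
    next
      fix L b c assume L: "boundary_affine_subspace k L"
        "M \<in> components (half_space_quadric X Y k b c \<inter> vertical_subspace k L)"
      show ?thesis
        using affine_quadric_section[OF L(1)] L(2)[unfolded quadric_section_eq_flat_section[OF hs]]
        by (intro exI conjI)
    qed
  qed
next
  fix L b c
  assume "boundary_affine_subspace k L \<and> b \<in> half_space_boundary k \<and>
    half_space_quadric X Y k b c \<inter> vertical_subspace k L \<noteq> {}"
  then have L: "boundary_affine_subspace k L"
    and ne: "half_space_quadric X Y k b c \<inter> vertical_subspace k L \<noteq> {}" by auto
  let ?E = "{v. v $ k - 2 * horizontal_form Y k b v = c - horizontal_form Y k b b} \<inter> boundary_projection k -` L"
  note eq = quadric_section_eq_flat_section[OF assms(3), of b c L]
  have "?E \<noteq> {}" using ne unfolding eq by (auto simp: flat_section_def)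
  then obtain e W where W: "subspace W" "?E = (+) e ` W"
    by (rule affine_eq_translated_subspace[OF affine_quadric_section[OF L]])
  show "\<exists>d. totally_geodesic (half_space k) (half_space_metric X Y k) d
          (half_space_quadric X Y k b c \<inter> vertical_subspace k L)"
    using totally_geodesic_flat_section[OF assms(3) W(1) ne[unfolded eq W(2)]]
    unfolding eq W(2) by (rule exI)
qed

end
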